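(* Let $\Theta$ be a decorated theory with pure subtheory $\Theta_0$, and let $\Theta_A=F_{\mathrm{exp}}\Theta$. Let $M_0$ be a model of $\Theta_0$ and $M_A$ a terminal model of $\Theta_A$ over $M_0$ (a terminal object of the category $\mathrm{Mod}(\Theta_A)|_{M_0}$). Then there is a bijection $$M_A(A)\;\cong\;\mathrm{Mod}(\Theta)|_{M_0}$$ which maps each $\alpha\in M_A(A)$ to the model $M_{A,\alpha}$ of $\Theta$ defined by $M_{A,\alpha}(X)=M_0(X)$ for each type $X$ and $M_{A,\alpha}(f)=M_A(f')(\alpha,-)$ for each term $f$, so that $M_{A,\alpha}(f)=M_A(f)$ for each pure term $f$.
   Context: Size issues are ignored. Theories. A (equational) theory is a category with chosen finite products; its objects are called types and its morphisms terms. Morphisms of theories are functors strictly preserving the chosen finite products. $\mathrm{Set}$ is the theory of sets with cartesian products as chosen products. Models. A model of a theory $\Theta$ is a morphism of theories $M\colon\Theta\to\mathrm{Set}$; morphisms of models are natural transformations. Given a morphism of theories $\theta\colon\Theta_1\to\Theta$ and a model $M_1$ of $\Theta_1$, $\mathrm{Mod}(\Theta)|_{M_1}$ is the category of models $M$ of $\Theta$ over $M_1$, i.e. with $M\circ\theta=M_1$, and of morphisms $m$ with $m\circ\theta=\mathrm{id}_{M_1}$. Here models of $\Theta$ and of $\Theta_A$ over $M_0$ refer to the inclusion $\Theta_0\to\Theta$ and to the canonical morphism $\Theta_0\to\Theta_A$ respectively; since $\Theta_0$ is wide in $\Theta$, $\mathrm{Mod}(\Theta)|_{M_0}$ is a discrete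 category, regarded as a set. Decorated theories. A decorated theory is a theory $\Theta$ together with a wide subtheory $\Theta_0$ (a subcategory with the same types, containing all identities and chosen projections, closed under composition and tuples, with the same chosen products). Terms of $\Theta_0$ are called pure. The construction $F_{\mathrm{exp}}$. In a theory with a distinguished type $A$, the projections from $A\times X$ are $\mathrm{pr}_X\colon A\times X\to A$ and $\varepsilon_X\colon A\times X\to X$. $F_{\mathrm{exp}}\Theta$ is the theory $\Theta_A$ with distinguished type $A$ generated by: the theory $\Theta_0$ (all types and pure terms of $\Theta$, with their identities, composites, chosen products and tuples, so that there is a morphism of theories $\Theta_0\to\Theta_A$), a new type $A$, and a term $f'\colon A\times X\to Y$ for each term $f\colon X\to Y$ of $\Theta$, subject to the relations: $f'=f\circ\varepsilon_X$ if $f$ is pure; $(g\circ f)'=g'\circ\langle \mathrm{pr}_X,f'\rangle$ for $f\colon X\to Y$, $g\colon Y\to Z$; and $\langle f_1,\dots,f_n\rangle'=\langle f_1',\dots,f_n'\rangle$ for all $n\ge 0$. That is, morphisms of theories $\Theta_A\to\Theta'$ correspond bijectively to a morphism of theories $\Theta_0\to\Theta'$, a type of $\Theta'$, and a family of terms of $\Theta'$ satisfying these relations. *)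

theory Defs
  imports Main "HOL-Library.FuncSet"
begin

section \<open>Categories and equational theories\<close>

record ('o, 'm) cat =
  Ob :: "'o set"
  Ar :: "'m set"
  Dom :: "'m \<Rightarrow> 'o"
  Cod :: "'m \<Rightarrow> 'o"
  Idt :: "'o \<Rightarrow> 'm"
  Cmp :: "'m \<Rightarrow> 'm \<Rightarrow> 'm"

definition hom :: "('o, 'm, 'z) cat_scheme \<Rightarrow> 'o \<Rightarrow> 'o \<Rightarrow> 'm set" where
  "hom C X Y = {f \<in> Ar C. Dom C f = X \<and> Cod C f = Y}"

text \<open>\<open>Cmp C g f\<close> is \<open>g \<circ> f\<close>; it is only meaningful if \<open>Cod C f = Dom C g\<close>.\<close>

locale category =
  fixes C :: "('o, 'm, 'z) cat_scheme"
  assumes Dom_in: "f \<in> Ar C \<Longrightarrow> Dom C f \<in> Ob C"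
    and Cod_in: "f \<in> Ar C \<Longrightarrow> Cod C f \<in> Ob C"
    and Idt_hom: "X \<in> Ob C \<Longrightarrow> Idt C X \<in> hom C X X"
    and Cmp_hom: "f \<in> hom C X Y \<Longrightarrow> g \<in> hom C Y Z \<Longrightarrow> Cmp C g f \<in> hom C X Z"
    and Cmp_Idt_left: "f \<in> hom C X Y \<Longrightarrow> Cmp C (Idt C Y) f = f"
    and Cmp_Idt_right: "f \<in> hom C X Y \<Longrightarrow> Cmp C f (Idt C X) = f"
    and Cmp_assoc: "f \<in> hom C W X \<Longrightarrow> g \<in> hom C X Y \<Longrightarrow> h \<in> hom C Y Z \<Longrightarrow>
      Cmp C h (Cmp C g f) = Cmp C (Cmp C h g) f"

definition terminal_object :: "('o, 'm, 'z) cat_scheme \<Rightarrow> 'o \<Rightarrow> bool" where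
  "terminal_object C t \<longleftrightarrow> t \<in> Ob C \<and> (\<forall>X \<in> Ob C. \<exists>!f. f \<in> hom C X t)"

text \<open>
  Chosen products are \<open>n\<close>-ary for every \<open>n \<ge> 0\<close>, indexed by lists of types. No relation is imposed
  between products of different arities; in particular the chosen product of a one-element list
  \<open>[X]\<close> may or may not be \<open>X\<close> itself.
\<close>

record ('o, 'm) thy = "('o, 'm) cat" +
  Prd :: "'o list \<Rightarrow> 'o"
  Prj :: "'o list \<Rightarrow> nat \<Rightarrow> 'm"

definition is_tuple :: "('o, 'm, 'z) thy_scheme \<Rightarrow> 'o \<Rightarrow> 'm list \<Rightarrow> 'm \<Rightarrow> bool" where
  "is_tuple T X fs h \<longleftrightarrow> h \<in> hom T X (Prd T (map (Cod T) fs)) \<and>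
    (\<forall>i < length fs. Cmp T (Prj T (map (Cod T) fs) i) h = fs ! i)"

text \<open>The source \<open>X\<close> is an explicit argument because \<open>fs\<close> may be empty.\<close>

definition tuple :: "('o, 'm, 'z) thy_scheme \<Rightarrow> 'o \<Rightarrow> 'm list \<Rightarrow> 'm" where
  "tuple T X fs = (THE h. is_tuple T X fs h)"

locale equational_theory = category T
  for T :: "('o, 'm, 'z) thy_scheme" +
  assumes Prd_in: "set Xs \<subseteq> Ob T \<Longrightarrow> Prd T Xs \<in> Ob T"
    and Prj_hom: "set Xs \<subseteq> Ob T \<Longrightarrow> i < length Xs \<Longrightarrow> Prj T Xs i \<in> hom T (Prd T Xs) (Xs ! i)"
    and ex1_tuple: "X \<in> Ob T \<Longrightarrow> set fs \<subseteq> Ar T \<Longrightarrow> (\<And>f. f \<in> set fs \<Longrightarrow> Dom T f = X) \<Longrightarrow>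
      \<exists>!h. is_tuple T X fs h"

text \<open>
  Functors are extensional (\<open>undefined\<close> outside the source category), so that equality of functors
  is the equality of HOL.
\<close>

record ('o1, 'm1, 'o2, 'm2) fctr =
  fob :: "'o1 \<Rightarrow> 'o2"
  far :: "'m1 \<Rightarrow> 'm2"

definition theory_morphism ::
  "('o1, 'm1, 'y) thy_scheme \<Rightarrow> ('o2, 'm2, 'z) thy_scheme \<Rightarrow> ('o1, 'm1, 'o2, 'm2) fctr \<Rightarrow> bool" where
  "theory_morphism S T F \<longleftrightarrow>
    fob F \<in> Ob S \<rightarrow>\<^sub>E Ob T \<and> far F \<in> Ar S \<rightarrow>\<^sub>E Ar T \<and>
    (\<forall>f \<in> Ar S. Dom T (far F f) = fob F (Dom S f) \<and> Cod T (far F f) = fob F (Cod S f)) \<and>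
    (\<forall>X \<in> Ob S. far F (Idt S X) = Idt T (fob F X)) \<and>
    (\<forall>f \<in> Ar S. \<forall>g \<in> Ar S. Cod S f = Dom S g \<longrightarrow>
      far F (Cmp S g f) = Cmp T (far F g) (far F f)) \<and>
    (\<forall>Xs. set Xs \<subseteq> Ob S \<longrightarrow> fob F (Prd S Xs) = Prd T (map (fob F) Xs)) \<and>
    (\<forall>Xs i. set Xs \<subseteq> Ob S \<longrightarrow> i < length Xs \<longrightarrow>
      far F (Prj S Xs i) = Prj T (map (fob F) Xs) i)"

definition fcomp :: "('o1, 'm1, 'z) cat_scheme \<Rightarrow> ('o2, 'm2, 'o3, 'm3) fctr \<Rightarrow>
    ('o1, 'm1, 'o2, 'm2) fctr \<Rightarrow> ('o1, 'm1, 'o3, 'm3) fctr" where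
  "fcomp S G F = \<lparr>fob = compose (Ob S) (fob G) (fob F), far = compose (Ar S) (far G) (far F)\<rparr>"

definition natural_transformation :: "('o1, 'm1, 'y) cat_scheme \<Rightarrow> ('o2, 'm2, 'z) cat_scheme \<Rightarrow>
    ('o1, 'm1, 'o2, 'm2) fctr \<Rightarrow> ('o1, 'm1, 'o2, 'm2) fctr \<Rightarrow> ('o1 \<Rightarrow> 'm2) \<Rightarrow> bool" where
  "natural_transformation C D F G m \<longleftrightarrow>
    m \<in> extensional (Ob C) \<and>
    (\<forall>X \<in> Ob C. m X \<in> hom D (fob F X) (fob G X)) \<and>
    (\<forall>f \<in> Ar C. Cmp D (far G f) (m (Dom C f)) = Cmp D (m (Cod C f)) (far F f))"


section \<open>The theory of sets\<close>

text \<open>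
  \<open>'u univ\<close> is a universe of elements closed under the formation of tuples, with \<open>'u\<close> an arbitrary
  type of atoms; its subsets are the objects of the theory of sets. The cartesian product of one
  set is this set itself, so a 1-tuple is its component; otherwise theories in which the chosen
  product of \<open>[X]\<close> is \<open>X\<close> would have essentially no models.
\<close>

datatype 'u univ = Atom 'u | Tup "'u univ list"

fun tup :: "'u univ list \<Rightarrow> 'u univ" where
  "tup [x] = x"
| "tup xs = Tup xs"

definition components :: "nat \<Rightarrow> 'u univ \<Rightarrow> 'u univ list" where
  "components n t = (THE xs. length xs = n \<and> tup xs = t)"

definition cart :: "'u univ set list \<Rightarrow> 'u univ set" where
  "cart Ss = {tup xs |xs. list_all2 (\<in>) xs Ss}"

datatype 'u setmap = SetMap (src: "'u univ set") (app: "'u univ \<Rightarrow> 'u univ") (tgt: "'u univ set")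

definition Sets :: "('u univ set, 'u setmap) thy" where
  "Sets = \<lparr>Ob = UNIV, Ar = {SetMap S h S' |S h S'. h \<in> S \<rightarrow>\<^sub>E S'}, Dom = src, Cod = tgt,
    Idt = (\<lambda>S. SetMap S (\<lambda>x \<in> S. x) S),
    Cmp = (\<lambda>g f. SetMap (src f) (compose (src f) (app g) (app f)) (tgt g)),
    Prd = cart,
    Prj = (\<lambda>Ss i. SetMap (cart Ss) (\<lambda>t \<in> cart Ss. components (length Ss) t ! i) (Ss ! i))\<rparr>"


section \<open>Models\<close>

type_synonym ('o, 'm, 'u) model = "('o, 'm, 'u univ set, 'u setmap) fctr"

definition is_model :: "('o, 'm, 'z) thy_scheme \<Rightarrow> ('o, 'm, 'u) model \<Rightarrow> bool" where
  "is_model T M \<longleftrightarrow> theory_morphism T Sets M"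

text \<open>
  \<open>Mod_over S T \<theta> M1\<close> is the category of models of \<open>T\<close> over the model \<open>M1\<close> of \<open>S\<close>, with respect to
  the morphism of theories \<open>\<theta>\<close> from \<open>S\<close> to \<open>T\<close>.
\<close>

definition Mod_over :: "('o1, 'm1, 'y) thy_scheme \<Rightarrow> ('o, 'm, 'z) thy_scheme \<Rightarrow>
    ('o1, 'm1, 'o, 'm) fctr \<Rightarrow> ('o1, 'm1, 'u) model \<Rightarrow>
    (('o, 'm, 'u) model, ('o, 'm, 'u) model \<times> ('o \<Rightarrow> 'u setmap) \<times> ('o, 'm, 'u) model) cat" where
  "Mod_over S T \<theta> M1 = (let Ms = {M. is_model T M \<and> fcomp S M \<theta> = M1} in
    \<lparr>Ob = Ms,
     Ar = {(M, m, N). M \<in> Ms \<and> N \<in> Ms \<and> natural_transformation T Sets M N m \<and>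
       (\<forall>X \<in> Ob S. m (fob \<theta> X) = Idt Sets (fob M1 X))},
     Dom = (\<lambda>(M, m, N). M), Cod = (\<lambda>(M, m, N). N),
     Idt = (\<lambda>M. (M, \<lambda>X \<in> Ob T. Idt Sets (fob M X), M)),
     Cmp = (\<lambda>(N, n, K) (M, m, _). (M, \<lambda>X \<in> Ob T. Cmp Sets (n X) (m X), K))\<rparr>)"


section \<open>Decorated theories\<close>

text \<open>A wide subtheory is given by its set \<open>P\<close> of terms.\<close>

locale decorated_theory = equational_theory T
  for T :: "('o, 'm) thy" +
  fixes P :: "'m set"
  assumes pure_Ar: "P \<subseteq> Ar T"
    and pure_Idt: "X \<in> Ob T \<Longrightarrow> Idt T X \<in> P"
    and pure_Prj: "set Xs \<subseteq> Ob T \<Longrightarrow> i < length Xs \<Longrightarrow> Prj T Xs i \<in> P"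
    and pure_Cmp: "f \<in> P \<Longrightarrow> g \<in> P \<Longrightarrow> Cod T f = Dom T g \<Longrightarrow> Cmp T g f \<in> P"
    and pure_tuple: "X \<in> Ob T \<Longrightarrow> set fs \<subseteq> P \<Longrightarrow> (\<And>f. f \<in> set fs \<Longrightarrow> Dom T f = X) \<Longrightarrow>
      tuple T X fs \<in> P"

definition pure_theory :: "('o, 'm) thy \<Rightarrow> 'm set \<Rightarrow> ('o, 'm) thy" where
  "pure_theory T P = T\<lparr>Ar := P\<rparr>"

definition pure_incl :: "('o, 'm) thy \<Rightarrow> 'm set \<Rightarrow> ('o, 'm, 'o, 'm) fctr" where
  "pure_incl T P = \<lparr>fob = (\<lambda>X \<in> Ob T. X), far = (\<lambda>f \<in> P. f)\<rparr>"


section \<open>The construction \<open>F\<^sub>e\<^sub>x\<^sub>p\<close>\<close>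

text \<open>
  The types of the generated theory are the formal products of \<open>Param\<close> (the new type \<open>A\<close>) and of
  types of \<open>T\<close>, a product of types of \<open>T\<close> being identified with their chosen product in \<open>T\<close>. They
  are represented by normal forms, in which \<open>Prod\<close> is never applied to a list consisting of \<open>Base\<close>
  types only.
\<close>

datatype 'o atype = is_Base: Base (the_Base: 'o) | Param | Prod "'o atype list"

definition aprod :: "('o, 'm) thy \<Rightarrow> 'o atype list \<Rightarrow> 'o atype" where
  "aprod T Zs = (if list_all is_Base Zs then Base (Prd T (map the_Base Zs)) else Prod Zs)"

inductive_set atypes :: "('o, 'm) thy \<Rightarrow> 'o atype set" for T where
  atypes_Base: "X \<in> Ob T \<Longrightarrow> Base X \<in> atypes T"
| atypes_Param: "Param \<in> atypes T"
| atypes_aprod: "Zs \<in> lists (atypes T) \<Longrightarrow> aprod T Zs \<in> atypes T"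

text \<open>
  The terms of the generated theory are the classes of well-typed raw terms modulo the congruence
  generated by the equations of a theory, by the equations making \<open>Pure\<close> a morphism of theories,
  and by the three relations on the terms \<open>f'\<close>, written \<open>Prime f\<close>.
\<close>

datatype ('o, 'm) raw =
    Pure 'm
  | Prime 'm
  | RId "'o atype"
  | RCmp "('o, 'm) raw" "('o, 'm) raw"
  | RPrj "'o atype list" nat
  | RTup "'o atype" "('o, 'm) raw list"

inductive typed :: "('o, 'm) thy \<Rightarrow> 'm set \<Rightarrow> 'o atype \<Rightarrow> 'o atype \<Rightarrow> ('o, 'm) raw \<Rightarrow> bool"
  for T P where
  typed_Pure: "f \<in> P \<Longrightarrow> typed T P (Base (Dom T f)) (Base (Cod T f)) (Pure f)"
| typed_Prime: "f \<in> Ar T \<Longrightarrow>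
    typed T P (aprod T [Param, Base (Dom T f)]) (Base (Cod T f)) (Prime f)"
| typed_RId: "X \<in> atypes T \<Longrightarrow> typed T P X X (RId X)"
| typed_RCmp: "typed T P Y Z t \<Longrightarrow> typed T P X Y s \<Longrightarrow> typed T P X Z (RCmp t s)"
| typed_RPrj: "set Ys \<subseteq> atypes T \<Longrightarrow> i < length Ys \<Longrightarrow>
    typed T P (aprod T Ys) (Ys ! i) (RPrj Ys i)"
| typed_RTup: "X \<in> atypes T \<Longrightarrow> list_all2 (typed T P X) Ys ts \<Longrightarrow>
    typed T P X (aprod T Ys) (RTup X ts)"

inductive equiv_raw ::
  "('o, 'm) thy \<Rightarrow> 'm set \<Rightarrow> 'o atype \<Rightarrow> 'o atype \<Rightarrow> ('o, 'm) raw \<Rightarrow> ('o, 'm) raw \<Rightarrow> bool"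
  for T P where
  eq_refl: "typed T P X Y t \<Longrightarrow> equiv_raw T P X Y t t"
| eq_sym: "equiv_raw T P X Y t s \<Longrightarrow> equiv_raw T P X Y s t"
| eq_trans: "equiv_raw T P X Y t s \<Longrightarrow> equiv_raw T P X Y s r \<Longrightarrow> equiv_raw T P X Y t r"
| eq_RCmp: "equiv_raw T P Y Z t t' \<Longrightarrow> equiv_raw T P X Y s s' \<Longrightarrow>
    equiv_raw T P X Z (RCmp t s) (RCmp t' s')"
| eq_RTup: "X \<in> atypes T \<Longrightarrow> length ts = length Ys \<Longrightarrow> length ts' = length Ys \<Longrightarrow>
    (\<And>i. i < length Ys \<Longrightarrow> equiv_raw T P X (Ys ! i) (ts ! i) (ts' ! i)) \<Longrightarrow>
    equiv_raw T P X (aprod T Ys) (RTup X ts) (RTup X ts')"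
| eq_id_left: "typed T P X Y t \<Longrightarrow> equiv_raw T P X Y (RCmp (RId Y) t) t"
| eq_id_right: "typed T P X Y t \<Longrightarrow> equiv_raw T P X Y (RCmp t (RId X)) t"
| eq_assoc: "typed T P W X r \<Longrightarrow> typed T P X Y s \<Longrightarrow> typed T P Y Z t \<Longrightarrow>
    equiv_raw T P W Z (RCmp t (RCmp s r)) (RCmp (RCmp t s) r)"
| eq_beta: "X \<in> atypes T \<Longrightarrow> list_all2 (typed T P X) Ys ts \<Longrightarrow> i < length Ys \<Longrightarrow>
    equiv_raw T P X (Ys ! i) (RCmp (RPrj Ys i) (RTup X ts)) (ts ! i)"
| eq_eta: "set Ys \<subseteq> atypes T \<Longrightarrow> typed T P X (aprod T Ys) t \<Longrightarrow>
    equiv_raw T P X (aprod T Ys) (RTup X (map (\<lambda>i. RCmp (RPrj Ys i) t) [0..<length Ys])) t"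
| eq_Pure_Idt: "X \<in> Ob T \<Longrightarrow> equiv_raw T P (Base X) (Base X) (Pure (Idt T X)) (RId (Base X))"
| eq_Pure_Cmp: "f \<in> P \<Longrightarrow> g \<in> P \<Longrightarrow> Cod T f = Dom T g \<Longrightarrow>
    equiv_raw T P (Base (Dom T f)) (Base (Cod T g)) (Pure (Cmp T g f)) (RCmp (Pure g) (Pure f))"
| eq_Pure_Prj: "set Xs \<subseteq> Ob T \<Longrightarrow> i < length Xs \<Longrightarrow>
    equiv_raw T P (Base (Prd T Xs)) (Base (Xs ! i)) (Pure (Prj T Xs i)) (RPrj (map Base Xs) i)"
| eq_Prime_pure: "f \<in> P \<Longrightarrow>
    equiv_raw T P (aprod T [Param, Base (Dom T f)]) (Base (Cod T f))
      (Prime f) (RCmp (Pure f) (RPrj [Param, Base (Dom T f)] 1))"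
| eq_Prime_Cmp: "f \<in> Ar T \<Longrightarrow> g \<in> Ar T \<Longrightarrow> Cod T f = Dom T g \<Longrightarrow>
    equiv_raw T P (aprod T [Param, Base (Dom T f)]) (Base (Cod T g))
      (Prime (Cmp T g f))
      (RCmp (Prime g) (RTup (aprod T [Param, Base (Dom T f)])
        [RPrj [Param, Base (Dom T f)] 0, Prime f]))"
| eq_Prime_tuple: "X \<in> Ob T \<Longrightarrow> set fs \<subseteq> Ar T \<Longrightarrow> (\<And>f. f \<in> set fs \<Longrightarrow> Dom T f = X) \<Longrightarrow>
    equiv_raw T P (aprod T [Param, Base X]) (Base (Prd T (map (Cod T) fs)))
      (Prime (tuple T X fs)) (RTup (aprod T [Param, Base X]) (map Prime fs))"

type_synonym ('o, 'm) aterm = "'o atype \<times> 'o atype \<times> ('o, 'm) raw set"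

definition aterm ::
  "('o, 'm) thy \<Rightarrow> 'm set \<Rightarrow> 'o atype \<Rightarrow> 'o atype \<Rightarrow> ('o, 'm) raw \<Rightarrow> ('o, 'm) aterm" where
  "aterm T P X Y t = (X, Y, {s. equiv_raw T P X Y t s})"

definition Fexp :: "('o, 'm) thy \<Rightarrow> 'm set \<Rightarrow> ('o atype, ('o, 'm) aterm) thy" where
  "Fexp T P = \<lparr>Ob = atypes T, Ar = {aterm T P X Y t |X Y t. typed T P X Y t},
    Dom = (\<lambda>(X, Y, c). X), Cod = (\<lambda>(X, Y, c). Y),
    Idt = (\<lambda>X. aterm T P X X (RId X)),
    Cmp = (\<lambda>(Y', Z, d) (X, Y, c).
      (X, Z, {r. \<exists>t \<in> d. \<exists>s \<in> c. equiv_raw T P X Z (RCmp t s) r})),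
    Prd = aprod T,
    Prj = (\<lambda>Ys i. aterm T P (aprod T Ys) (Ys ! i) (RPrj Ys i))\<rparr>"

definition prime_term :: "('o, 'm) thy \<Rightarrow> 'm set \<Rightarrow> 'm \<Rightarrow> ('o, 'm) aterm" where
  "prime_term T P f = aterm T P (aprod T [Param, Base (Dom T f)]) (Base (Cod T f)) (Prime f)"

definition Fexp_incl :: "('o, 'm) thy \<Rightarrow> 'm set \<Rightarrow> ('o, 'm, 'o atype, ('o, 'm) aterm) fctr" where
  "Fexp_incl T P = \<lparr>fob = (\<lambda>X \<in> Ob T. Base X),
    far = (\<lambda>f \<in> P. aterm T P (Base (Dom T f)) (Base (Cod T f)) (Pure f))\<rparr>"


section \<open>The model of \<open>T\<close> at a parameter value\<close>

text \<open>The element \<open>(\<alpha>, x)\<close> of the cartesian product of \<open>M\<^sub>A(A)\<close> and \<open>M\<^sub>0(X)\<close> is \<open>tup [\<alpha>, x]\<close>.\<close>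

definition model_at :: "('o, 'm) thy \<Rightarrow> 'm set \<Rightarrow> ('o, 'm, 'u) model \<Rightarrow>
    ('o atype, ('o, 'm) aterm, 'u) model \<Rightarrow> 'u univ \<Rightarrow> ('o, 'm, 'u) model" where
  "model_at T P M0 MA \<alpha> =
    \<lparr>fob = (\<lambda>X \<in> Ob T. fob M0 X),
     far = (\<lambda>f \<in> Ar T. SetMap (fob M0 (Dom T f))
       (\<lambda>x \<in> fob M0 (Dom T f). app (far MA (prime_term T P f)) (tup [\<alpha>, x]))
       (fob M0 (Cod T f)))\<rparr>"


section \<open>Sets and pure subtheories are theories\<close>

lemma hom_iff: "f \<in> hom C X Y \<longleftrightarrow> f \<in> Ar C \<and> Dom C f = X \<and> Cod C f = Y"
  by (auto simp: hom_def)

lemma tup_inject: "length xs = length ys \<Longrightarrow> tup xs = tup ys \<longleftrightarrow> xs = ys"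
  by (cases xs rule: tup.cases; cases ys rule: tup.cases) auto

lemma components_tup [simp]: "components (length xs) (tup xs) = xs"
  unfolding components_def by (rule the_equality) (auto simp: tup_inject)

lemma Sets_simps [simp]: "Ob Sets = UNIV" "Dom Sets = src" "Cod Sets = tgt" "Prd Sets = cart"
  "Idt Sets S = SetMap S (\<lambda>x \<in> S. x) S"
  "Cmp Sets g f = SetMap (src f) (compose (src f) (app g) (app f)) (tgt g)"
  "Prj Sets Ss i = SetMap (cart Ss) (\<lambda>t \<in> cart Ss. components (length Ss) t ! i) (Ss ! i)"
  by (simp_all add: Sets_def)

lemma Sets_Ar_iff: "f \<in> Ar Sets \<longleftrightarrow> app f \<in> src f \<rightarrow>\<^sub>E tgt f"
  by (cases f) (auto simp: Sets_def)

lemma Sets_hom_iff: "f \<in> hom Sets S S' \<longleftrightarrow> src f = S \<and> tgt f = S' \<and> app f \<in> S \<rightarrow>\<^sub>E S'"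
  by (auto simp: hom_def Sets_Ar_iff)

theorem Sets_theory: "equational_theory (Sets :: ('u univ set, 'u setmap) thy)"
proof
  fix X :: "'u univ set" and fs :: "'u setmap list"
  assume fs: "set fs \<subseteq> Ar Sets" "\<And>f. f \<in> set fs \<Longrightarrow> Dom Sets f = X"
  let ?h = "SetMap X (\<lambda>x \<in> X. tup (map (\<lambda>f. app f x) fs)) (cart (map tgt fs))"
  have a: "tup (map (\<lambda>f. app f x) fs) \<in> cart (map tgt fs)" if "x \<in> X" for x
    using fs that by (auto simp: cart_def list_all2_map1 list_all2_map2 list_all2_same
      intro!: exI[of _ "map (\<lambda>f. app f x) fs"]) (force simp: Sets_Ar_iff)
  have b: "components (length fs) (tup (map (\<lambda>f. app f x) fs)) = map (\<lambda>f. app f x) fs" for x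
    using components_tup[of "map (\<lambda>f. app f x) fs"] by simp
  show "\<exists>!h. is_tuple Sets X fs h"
  proof
    show "is_tuple Sets X fs ?h"
      unfolding is_tuple_def
    proof (intro conjI allI impI)
      show "?h \<in> hom Sets X (Prd Sets (map (Cod Sets) fs))"
        using a by (auto simp: Sets_hom_iff)
      fix i assume i: "i < length fs"
      have "fs ! i \<in> Ar Sets" "src (fs ! i) = X"
        using fs nth_mem[OF i] by auto
      then have "app (fs ! i) \<in> extensional X" "src (fs ! i) = X"
        by (auto simp: Sets_Ar_iff PiE_def)
      then show "Cmp Sets (Prj Sets (map (Cod Sets) fs) i) ?h = fs ! i"
        using i a b by (intro setmap.expand) (auto simp: compose_def extensional_def fun_eq_iff)
    qed
  next
    fix h assume h: "is_tuple Sets X fs h"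
    then have hh: "src h = X" "tgt h = cart (map tgt fs)" "app h \<in> X \<rightarrow>\<^sub>E cart (map tgt fs)"
      by (auto simp: is_tuple_def Sets_hom_iff)
    have "app h x = tup (map (\<lambda>f. app f x) fs)" if x: "x \<in> X" for x
    proof -
      have hx: "app h x \<in> cart (map tgt fs)" using hh x by auto
      then obtain xs where xs: "app h x = tup xs" "length xs = length fs"
        by (auto simp: cart_def dest: list_all2_lengthD)
      have "xs ! i = app (fs ! i) x" if i: "i < length fs" for i
      proof -
        have "fs ! i = Cmp Sets (Prj Sets (map (Cod Sets) fs) i) h" using h i by (simp add: is_tuple_def)
        then have "app (fs ! i) x = components (length fs) (app h x) ! i"
          using hh x hx by (simp add: compose_def)
        then show ?thesis using xs components_tup[of xs] by simp
      qed
      then have "xs = map (\<lambda>f. app f x) fs" using xs by (auto intro: nth_equalityI)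
      then show ?thesis using xs by simp
    qed
    then have "app h = (\<lambda>x \<in> X. tup (map (\<lambda>f. app f x) fs))"
      using hh by (auto simp: fun_eq_iff PiE_def extensional_def)
    then show "h = ?h" using hh by (intro setmap.expand) auto
  qed
next
  fix Xs :: "'u univ set list" and i assume i: "i < length Xs"
  show "Prj Sets Xs i \<in> hom Sets (Prd Sets Xs) (Xs ! i)"
    unfolding Sets_hom_iff
  proof (auto)
    fix t assume "t \<in> cart Xs"
    then obtain xs where "t = tup xs" "list_all2 (\<in>) xs Xs" by (auto simp: cart_def)
    then show "components (length Xs) t ! i \<in> Xs ! i"
      using i components_tup[of xs] by (auto simp: list_all2_conv_all_nth)
  qed
next
  fix X Y :: "'u univ set" and f assume "f \<in> hom Sets X Y"
  then show "Cmp Sets (Idt Sets Y) f = f" "Cmp Sets f (Idt Sets X) = f"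
    by (cases f; auto simp: Sets_hom_iff compose_def fun_eq_iff PiE_def extensional_def)+
next
  fix W X Y Z :: "'u univ set" and f g h
  assume "f \<in> hom Sets W X" "g \<in> hom Sets X Y" "h \<in> hom Sets Y Z"
  then show "Cmp Sets h (Cmp Sets g f) = Cmp Sets (Cmp Sets h g) f"
    by (auto simp: Sets_hom_iff compose_def fun_eq_iff PiE_def Pi_def)
qed (auto simp: Sets_hom_iff compose_def)

lemma pure_is_theory:
  assumes "decorated_theory T P" shows "equational_theory (pure_theory T P)"
proof -
  interpret decorated_theory T P by fact
  have s [simp]: "Ob (pure_theory T P) = Ob T" "Ar (pure_theory T P) = P"
  "Dom (pure_theory T P) = Dom T" "Cod (pure_theory T P) = Cod T" "Idt (pure_theory T P) = Idt T"
  "Cmp (pure_theory T P) = Cmp T" "Prd (pure_theory T P) = Prd T" "Prj (pure_theory T P) = Prj T"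
  by (auto simp: pure_theory_def)
  have h: "f \<in> hom (pure_theory T P) X Y \<longleftrightarrow> f \<in> P \<and> f \<in> hom T X Y" for f X Y
    using pure_Ar by (auto simp: hom_def)
  have t: "is_tuple (pure_theory T P) X fs k \<longleftrightarrow> k \<in> P \<and> is_tuple T X fs k" for X fs k
    by (auto simp: is_tuple_def h)
  show ?thesis
  proof
    fix X fs assume a: "X \<in> Ob (pure_theory T P)" "set fs \<subseteq> Ar (pure_theory T P)"
      "\<And>f. f \<in> set fs \<Longrightarrow> Dom (pure_theory T P) f = X"
    then have e: "\<exists>!k. is_tuple T X fs k" using pure_Ar by (intro ex1_tuple) auto
    moreover have "is_tuple T X fs (tuple T X fs)" unfolding tuple_def by (rule theI'[OF e])
    moreover have "tuple T X fs \<in> P" using a by (intro pure_tuple) auto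
    ultimately show "\<exists>!k. is_tuple (pure_theory T P) X fs k" unfolding t by blast
  qed (insert pure_Ar, simp_all only: h s, auto simp: hom_iff intro: Dom_in Cod_in Prd_in pure_Idt pure_Prj pure_Cmp
     Idt_hom[unfolded hom_iff, THEN conjunct2, THEN conjunct1] Idt_hom[unfolded hom_iff, THEN conjunct2, THEN conjunct2]
     Cmp_Idt_left Cmp_Idt_right Cmp_assoc dest: Prj_hom[unfolded hom_iff] Cmp_hom[unfolded hom_iff, OF conjI[OF _ conjI[OF refl refl]] conjI[OF _ conjI[OF sym refl]]])
qed


section \<open>The universal property of \<open>F\<^sub>e\<^sub>x\<^sub>p\<close>\<close>

lemma aprod_map_Base [simp]: "aprod T (map Base Xs) = Base (Prd T Xs)"
  by (simp add: aprod_def list_all_iff comp_def)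

lemma aprod_in: "set Ys \<subseteq> atypes T \<Longrightarrow> aprod T Ys \<in> atypes T"
  by (rule atypes_aprod) auto

context equational_theory begin

lemma is_tuple_tuple:
  assumes "X \<in> Ob T" "set fs \<subseteq> Ar T" "\<And>f. f \<in> set fs \<Longrightarrow> Dom T f = X"
  shows "is_tuple T X fs (tuple T X fs)"
  unfolding tuple_def by (rule theI') (rule ex1_tuple[OF assms])

lemma tuple_eqI:
  assumes "X \<in> Ob T" "set fs \<subseteq> Ar T" "\<And>f. f \<in> set fs \<Longrightarrow> Dom T f = X" "is_tuple T X fs h"
  shows "tuple T X fs = h"
  using ex1_tuple[OF assms(1-3)] is_tuple_tuple[OF assms(1-3)] assms(4) by blast

end

context decorated_theory begin

abbreviation "ty \<equiv> typed T P"
abbreviation "eqr \<equiv> equiv_raw T P"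
abbreviation "E \<equiv> Fexp T P"

lemma typed_in: "ty X Y t \<Longrightarrow> X \<in> atypes T \<and> Y \<in> atypes T"
proof (induction rule: typed.induct)
  case (typed_Pure f)
  then show ?case using pure_Ar by (auto intro: atypes_Base Dom_in Cod_in)
next
  case (typed_Prime f)
  then show ?case by (auto intro!: aprod_in atypes.intros Dom_in Cod_in)
next
  case (typed_RTup X Ys ts)
  then have "set Ys \<subseteq> atypes T"
    by (auto simp: list_all2_conv_all_nth in_set_conv_nth)
  then show ?case using typed_RTup aprod_in by auto
qed (auto intro: aprod_in)

lemma Pure_hom: "f \<in> P \<Longrightarrow> f \<in> hom T X Y \<Longrightarrow> ty (Base X) (Base Y) (Pure f)"
  using typed_Pure[of f P T] by (auto simp: hom_iff)
lemma Prime_hom: "f \<in> hom T X Y \<Longrightarrow> ty (aprod T [Param, Base X]) (Base Y) (Prime f)"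
  using typed_Prime[of f T P] by (auto simp: hom_iff)

lemma Prj_typed:
  assumes "X \<in> Ob T"
  shows "ty (aprod T [Param, Base X]) Param (RPrj [Param, Base X] 0)"
    "ty (aprod T [Param, Base X]) (Base X) (RPrj [Param, Base X] (Suc 0))"
  using typed_RPrj[of "[Param, Base X]" T 0 P] typed_RPrj[of "[Param, Base X]" T 1 P] assms
  by (auto intro: atypes.intros)

lemma equiv_typed: "eqr X Y t s \<Longrightarrow> ty X Y t \<and> ty X Y s"
proof (induction rule: equiv_raw.induct)
  case (eq_RTup X ts Ys ts')
  then show ?case by (auto intro!: typed_RTup simp: list_all2_conv_all_nth)
next
  case (eq_id_left X Y t)
  then show ?case using typed_in by (blast intro: typed.intros)
next
  case (eq_id_right X Y t)
  then show ?case using typed_in by (blast intro: typed.intros)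
next
  case (eq_beta X Ys ts i)
  moreover have "set Ys \<subseteq> atypes T"
    using eq_beta typed_in by (auto simp: list_all2_conv_all_nth in_set_conv_nth) blast
  ultimately show ?case
    by (auto intro!: typed_RCmp typed_RPrj typed_RTup simp: list_all2_conv_all_nth)
next
  case (eq_eta Ys X t)
  then show ?case
    using typed_in[OF eq_eta(2)] 
    by (auto intro!: typed_RTup typed_RCmp typed_RPrj simp: list_all2_conv_all_nth)
next
  case (eq_Pure_Idt X)
  then show ?case by (auto intro: Pure_hom Idt_hom pure_Idt typed.intros atypes.intros)
next
  case (eq_Pure_Cmp f g)
  then have "Cmp T g f \<in> hom T (Dom T f) (Cod T g)"
    using pure_Ar by (intro Cmp_hom) (auto simp: hom_iff)
  then show ?case using eq_Pure_Cmp
    by (metis Pure_hom pure_Cmp typed_Pure typed_RCmp)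
next
  case (eq_Pure_Prj Xs i)
  then have "set (map Base Xs) \<subseteq> atypes T" by (auto intro: atypes_Base)
  then show ?case
    using typed_RPrj[of "map Base Xs" T i P] eq_Pure_Prj
    by (auto intro!: Pure_hom Prj_hom pure_Prj)
next
  case (eq_Prime_pure f)
  then show ?case using pure_Ar
    by (auto intro!: typed_RCmp[OF typed_Pure] Prj_typed typed_Prime Dom_in)
next
  case (eq_Prime_Cmp f g)
  then have "Cmp T g f \<in> hom T (Dom T f) (Cod T g)"
    using pure_Ar by (intro Cmp_hom) (auto simp: hom_iff)
  moreover have "ty (aprod T [Param, Base (Dom T f)]) (aprod T [Param, Base (Cod T f)])
     (RTup (aprod T [Param, Base (Dom T f)]) [RPrj [Param, Base (Dom T f)] 0, Prime f])"
    using eq_Prime_Cmp Dom_in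
    by (intro typed_RTup) (auto intro!: aprod_in atypes.intros Prj_typed Prime_hom simp: hom_iff)
  ultimately show ?case using eq_Prime_Cmp
    by (auto intro!: Prime_hom typed_RCmp[OF typed_Prime])
next
  case (eq_Prime_tuple X fs)
  then have "tuple T X fs \<in> hom T X (Prd T (map (Cod T) fs))"
    using is_tuple_tuple by (auto simp: is_tuple_def)
  moreover have "ty (aprod T [Param, Base X]) (aprod T (map Base (map (Cod T) fs)))
      (RTup (aprod T [Param, Base X]) (map Prime fs))"
    using eq_Prime_tuple
    by (intro typed_RTup) (auto intro!: aprod_in atypes.intros Prime_hom
      simp: list_all2_conv_all_nth hom_iff subset_iff)
  ultimately show ?case by (auto simp del: map_map intro: Prime_hom)
qed (auto intro: typed.intros)

lemma aterm_eq_iff: "ty X Y t \<Longrightarrow>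
  aterm T P X Y t = aterm T P X' Y' s \<longleftrightarrow> X' = X \<and> Y' = Y \<and> eqr X Y t s"
  unfolding aterm_def by (auto intro: equiv_raw.intros)

lemma Fexp_hom_iff: "a \<in> hom E X Y \<longleftrightarrow> (\<exists>t. ty X Y t \<and> a = aterm T P X Y t)"
  by (auto simp: hom_iff Fexp_def aterm_def)

lemma Cmp_aterm: "ty Y Z t \<Longrightarrow> ty X Y s \<Longrightarrow>
    Cmp E (aterm T P Y Z t) (aterm T P X Y s) = aterm T P X Z (RCmp t s)"
  by (auto simp: aterm_def Fexp_def intro: eq_RCmp eq_trans eq_refl eq_sym)

lemma Fexp_simps [simp]: "Ob E = atypes T" "Prd E = aprod T"
  "Idt E X = aterm T P X X (RId X)" "Prj E Ys i = aterm T P (aprod T Ys) (Ys ! i) (RPrj Ys i)"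
  by (auto simp: Fexp_def)

lemma Cod_aterm [simp]: "Cod E (aterm T P X Y t) = Y" and Dom_aterm [simp]: "Dom E (aterm T P X Y t) = X"
  by (auto simp: Fexp_def aterm_def)

lemma Fexp_Ar_iff: "a \<in> Ar E \<longleftrightarrow> (\<exists>X Y t. ty X Y t \<and> a = aterm T P X Y t)"
  by (auto simp: Fexp_def)

lemma aterm_is_tuple:
  assumes X: "X \<in> atypes T" and l: "list_all2 (ty X) Ys ts" 
  shows "is_tuple E X (map2 (aterm T P X) Ys ts) h \<longleftrightarrow> h = aterm T P X (aprod T Ys) (RTup X ts)"
proof -
  have len: "length Ys = length ts" using l by (rule list_all2_lengthD)
  have c: "map (Cod E) (map2 (aterm T P X) Ys ts) = Ys"
    using len by (auto intro!: nth_equalityI)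
  have tyn: "ty X (Ys ! i) (ts ! i)" if "i < length Ys" for i
    using l that by (auto simp: list_all2_conv_all_nth)
  have Ys: "set Ys \<subseteq> atypes T" using typed_in[OF tyn] by (auto simp: in_set_conv_nth)
  have tt: "ty X (aprod T Ys) (RTup X ts)" using X l by (rule typed_RTup)
  show ?thesis
  proof
    assume "is_tuple E X (map2 (aterm T P X) Ys ts) h"
    then have h: "h \<in> hom E X (aprod T Ys)" and
      hp: "\<And>i. i < length Ys \<Longrightarrow> Cmp E (Prj E Ys i) h = aterm T P X (Ys ! i) (ts ! i)"
      using len unfolding is_tuple_def c by auto
    obtain t where t: "ty X (aprod T Ys) t" "h = aterm T P X (aprod T Ys) t"
      using h by (auto simp: Fexp_hom_iff)
    have "eqr X (Ys ! i) (RCmp (RPrj Ys i) t) (ts ! i)" if i: "i < length Ys" for i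
    proof -
      have pt: "ty (aprod T Ys) (Ys ! i) (RPrj Ys i)" using i Ys by (intro typed_RPrj)
      have "aterm T P X (Ys ! i) (RCmp (RPrj Ys i) t) = aterm T P X (Ys ! i) (ts ! i)"
        using hp[OF i] Cmp_aterm[OF pt t(1)] t(2) by simp
      then show ?thesis using aterm_eq_iff[OF typed_RCmp[OF pt t(1)]] by simp
    qed
    then have "eqr X (aprod T Ys) (RTup X (map (\<lambda>i. RCmp (RPrj Ys i) t) [0..<length Ys])) (RTup X ts)"
      using len by (intro eq_RTup X) auto
    moreover have "eqr X (aprod T Ys) (RTup X (map (\<lambda>i. RCmp (RPrj Ys i) t) [0..<length Ys])) t"
      by (rule eq_eta[OF Ys t(1)])
    ultimately have "eqr X (aprod T Ys) t (RTup X ts)" by (blast intro: eq_sym eq_trans)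
    then show "h = aterm T P X (aprod T Ys) (RTup X ts)" using t aterm_eq_iff by simp
  next
    assume h: "h = aterm T P X (aprod T Ys) (RTup X ts)"
    show "is_tuple E X (map2 (aterm T P X) Ys ts) h"
      unfolding is_tuple_def c
    proof (intro conjI allI impI)
      show "h \<in> hom E X (Prd E Ys)" using h tt by (auto simp: Fexp_hom_iff)
      fix i assume "i < length (map2 (aterm T P X) Ys ts)"
      then have i: "i < length Ys" by simp
      have pt: "ty (aprod T Ys) (Ys ! i) (RPrj Ys i)" using i Ys by (intro typed_RPrj)
      have "eqr X (Ys ! i) (RCmp (RPrj Ys i) (RTup X ts)) (ts ! i)" by (rule eq_beta[OF X l i])
      then show "Cmp E (Prj E Ys i) h = map2 (aterm T P X) Ys ts ! i"
        using i len h Cmp_aterm[OF pt tt] aterm_eq_iff[OF typed_RCmp[OF pt tt]] by simp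
    qed
  qed
qed

lemma aterm_list:
  assumes "set fs \<subseteq> Ar E" "\<And>f. f \<in> set fs \<Longrightarrow> Dom E f = X"
  shows "\<exists>Ys ts. list_all2 (ty X) Ys ts \<and> fs = map2 (aterm T P X) Ys ts"
  using assms
proof (induction fs)
  case Nil
  then show ?case by (auto intro: exI[of _ "[]"])
next
  case (Cons f fs)
  then obtain Ys ts where "list_all2 (ty X) Ys ts" "fs = map2 (aterm T P X) Ys ts" by auto
  moreover obtain Y t where "ty X Y t" "f = aterm T P X Y t"
    using Cons.prems(1) Cons.prems(2)[of f] by (force simp: Fexp_Ar_iff)
  ultimately show ?case by (intro exI[of _ "Y # Ys"] exI[of _ "t # ts"]) auto
qed

theorem Fexp_theory: "equational_theory E"
proof
  fix f assume "f \<in> Ar E" then show "Dom E f \<in> Ob E" "Cod E f \<in> Ob E"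
    by (auto simp: Fexp_Ar_iff dest: typed_in)
next
  fix X assume "X \<in> Ob E" then show "Idt E X \<in> hom E X X"
    by (auto simp: Fexp_hom_iff intro: typed_RId)
next
  fix X Y Z f g assume "f \<in> hom E X Y" "g \<in> hom E Y Z"
  then obtain s t where "ty X Y s" "f = aterm T P X Y s" "ty Y Z t" "g = aterm T P Y Z t"
    by (auto simp: Fexp_hom_iff)
  then show "Cmp E g f \<in> hom E X Z"
    using Cmp_aterm typed_RCmp by (metis Fexp_hom_iff)
next
  fix X Y f assume "f \<in> hom E X Y"
  then obtain s where s: "ty X Y s" "f = aterm T P X Y s" by (auto simp: Fexp_hom_iff)
  then have i: "ty X X (RId X)" "ty Y Y (RId Y)" using typed_in by (auto intro: typed_RId)
  show "Cmp E (Idt E Y) f = f"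
    using s Cmp_aterm[OF i(2) s(1)] aterm_eq_iff[OF typed_RCmp[OF i(2) s(1)]] eq_id_left[OF s(1)] by simp
  show "Cmp E f (Idt E X) = f"
    using s Cmp_aterm[OF s(1) i(1)] aterm_eq_iff[OF typed_RCmp[OF s(1) i(1)]] eq_id_right[OF s(1)] by simp
next
  fix W X Y Z f g h assume "f \<in> hom E W X" "g \<in> hom E X Y" "h \<in> hom E Y Z"
  then obtain r s t where r: "ty W X r" "f = aterm T P W X r" and s: "ty X Y s" "g = aterm T P X Y s"
    and t: "ty Y Z t" "h = aterm T P Y Z t"
    by (auto simp: Fexp_hom_iff)
  note c = Cmp_aterm typed_RCmp r(1) s(1) t(1)
  have "Cmp E h (Cmp E g f) = aterm T P W Z (RCmp t (RCmp s r))"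
    by (simp add: r s t Cmp_aterm[OF s(1) r(1)] Cmp_aterm[OF t(1) typed_RCmp[OF s(1) r(1)]])
  also have "\<dots> = aterm T P W Z (RCmp (RCmp t s) r)"
    by (subst aterm_eq_iff) (auto intro: typed_RCmp r s t eq_assoc[OF r(1) s(1) t(1)])
  also have "\<dots> = Cmp E (Cmp E h g) f"
    by (simp add: r s t Cmp_aterm[OF t(1) s(1)] Cmp_aterm[OF typed_RCmp[OF t(1) s(1)] r(1)])
  finally show "Cmp E h (Cmp E g f) = Cmp E (Cmp E h g) f" .
next
  fix Xs assume "set Xs \<subseteq> Ob E" then show "Prd E Xs \<in> Ob E" by (simp add: aprod_in)
next
  fix Xs i assume "set Xs \<subseteq> Ob E" "i < length Xs"
  then show "Prj E Xs i \<in> hom E (Prd E Xs) (Xs ! i)" by (auto simp: Fexp_hom_iff intro: typed_RPrj)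
next
  fix X fs assume X: "X \<in> Ob E" and "set fs \<subseteq> Ar E" "\<And>f. f \<in> set fs \<Longrightarrow> Dom E f = X"
  then obtain Ys ts where l: "list_all2 (ty X) Ys ts" and fs: "fs = map2 (aterm T P X) Ys ts"
    using aterm_list[of fs X] by metis
  have "X \<in> atypes T" using X by simp
  from aterm_is_tuple[OF this l] show "\<exists>!h. is_tuple E X fs h" unfolding fs by simp
qed


lemma Base_in_atypes: "Z \<in> atypes T \<Longrightarrow> Z = Base X \<Longrightarrow> X \<in> Ob T"
proof (induction arbitrary: X rule: atypes.induct)
  case (atypes_aprod Zs)
  then have "list_all is_Base Zs" and X: "X = Prd T (map the_Base Zs)"
    by (auto simp: aprod_def split: if_splits)
  then have "the_Base Z \<in> Ob T" if "Z \<in> set Zs" for Z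
    using that atypes_aprod.IH by (auto simp: list_all_iff)
  then show ?case unfolding X by (intro Prd_in) auto
qed auto

end

lemma theory_morphism_hom: "theory_morphism S T F \<Longrightarrow> f \<in> hom S X Y \<Longrightarrow>
    far F f \<in> hom T (fob F X) (fob F Y)"
  unfolding theory_morphism_def hom_iff by auto

lemma theory_morphism_Cmp: "theory_morphism S T F \<Longrightarrow> f \<in> hom S X Y \<Longrightarrow> g \<in> hom S Y Z \<Longrightarrow>
    far F (Cmp S g f) = Cmp T (far F g) (far F f)"
  unfolding theory_morphism_def hom_iff by metis

lemma theory_morphism_Prd: "theory_morphism S T F \<Longrightarrow> set Xs \<subseteq> Ob S \<Longrightarrow>
    fob F (Prd S Xs) = Prd T (map (fob F) Xs)"
  and theory_morphism_Prj: "theory_morphism S T F \<Longrightarrow> set Xs \<subseteq> Ob S \<Longrightarrow> i < length Xs \<Longrightarrow>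
    far F (Prj S Xs i) = Prj T (map (fob F) Xs) i"
  and theory_morphism_Idt: "theory_morphism S T F \<Longrightarrow> X \<in> Ob S \<Longrightarrow> far F (Idt S X) = Idt T (fob F X)"
  and theory_morphism_Ob: "theory_morphism S T F \<Longrightarrow> X \<in> Ob S \<Longrightarrow> fob F X \<in> Ob T"
  unfolding theory_morphism_def by auto

lemma theory_morphism_tuple:
  assumes S: "equational_theory S" and F: "theory_morphism S T F"
    and fs: "set fs \<subseteq> Ar S" "\<And>f. f \<in> set fs \<Longrightarrow> Dom S f = X" and h: "is_tuple S X fs h"
  shows "is_tuple T (fob F X) (map (far F) fs) (far F h)"
proof -
  interpret S: equational_theory S by fact
  have Ys: "set (map (Cod S) fs) \<subseteq> Ob S" using fs S.Cod_in by auto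
  have c: "map (Cod T) (map (far F) fs) = map (fob F) (map (Cod S) fs)"
    using F fs by (auto simp: theory_morphism_def)
  have hh: "h \<in> hom S X (Prd S (map (Cod S) fs))" using h by (simp add: is_tuple_def)
  show ?thesis unfolding is_tuple_def c
  proof (intro conjI allI impI)
    show "far F h \<in> hom T (fob F X) (Prd T (map (fob F) (map (Cod S) fs)))"
      using theory_morphism_hom[OF F hh] theory_morphism_Prd[OF F Ys] by simp
    fix i assume "i < length (map (far F) fs)"
    then have i: "i < length fs" by simp
    have "far F (Cmp S (Prj S (map (Cod S) fs) i) h) =
        Cmp T (far F (Prj S (map (Cod S) fs) i)) (far F h)"
      using i by (intro theory_morphism_Cmp[OF F hh S.Prj_hom[OF Ys]]) auto
    then show "Cmp T (Prj T (map (fob F) (map (Cod S) fs)) i) (far F h) = map (far F) fs ! i"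
      using i h theory_morphism_Prj[OF F Ys, of i] by (simp add: is_tuple_def)
  qed
qed

text \<open>
  \<open>Fexp_data T P T' F B \<phi>\<close>: the morphism \<open>F\<close> from the pure subtheory to \<open>T'\<close>, the type \<open>B\<close> and the
  family of terms \<open>\<phi>\<close> of \<open>T'\<close> satisfy the relations defining \<open>Fexp T P\<close>. The theorems
  \<open>Fexp_data_Fexp\<close> and \<open>Fexp_universal\<close> state that \<open>Fexp T P\<close> is the universal theory with such data.
\<close>

definition Fexp_data :: "('o, 'm) thy \<Rightarrow> 'm set \<Rightarrow> ('p, 'n, 'z) thy_scheme \<Rightarrow>
    ('o, 'm, 'p, 'n) fctr \<Rightarrow> 'p \<Rightarrow> ('m \<Rightarrow> 'n) \<Rightarrow> bool" where
  "Fexp_data T P T' F B \<phi> \<longleftrightarrow>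
    theory_morphism (pure_theory T P) T' F \<and> B \<in> Ob T' \<and> \<phi> \<in> extensional (Ar T) \<and>
    (\<forall>f \<in> Ar T. \<phi> f \<in> hom T' (Prd T' [B, fob F (Dom T f)]) (fob F (Cod T f))) \<and>
    (\<forall>f \<in> P. \<phi> f = Cmp T' (far F f) (Prj T' [B, fob F (Dom T f)] 1)) \<and>
    (\<forall>f \<in> Ar T. \<forall>g \<in> Ar T. Cod T f = Dom T g \<longrightarrow>
      \<phi> (Cmp T g f) = Cmp T' (\<phi> g) (tuple T' (Prd T' [B, fob F (Dom T f)])
        [Prj T' [B, fob F (Dom T f)] 0, \<phi> f])) \<and>
    (\<forall>X \<in> Ob T. \<forall>fs. set fs \<subseteq> Ar T \<longrightarrow> (\<forall>f \<in> set fs. Dom T f = X) \<longrightarrow>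
      \<phi> (tuple T X fs) = tuple T' (Prd T' [B, fob F X]) (map \<phi> fs))"

primrec interp_ob :: "('p, 'n, 'z) thy_scheme \<Rightarrow> ('o, 'm, 'p, 'n) fctr \<Rightarrow> 'p \<Rightarrow> 'o atype \<Rightarrow> 'p" where
  "interp_ob T' F B (Base X) = fob F X"
| "interp_ob T' F B Param = B"
| "interp_ob T' F B (Prod Zs) = Prd T' (map (interp_ob T' F B) Zs)"

primrec interp_ar :: "('p, 'n, 'z) thy_scheme \<Rightarrow> ('o, 'm, 'p, 'n) fctr \<Rightarrow> 'p \<Rightarrow> ('m \<Rightarrow> 'n) \<Rightarrow> ('o, 'm) raw \<Rightarrow> 'n" where
  "interp_ar T' F B \<phi> (Pure f) = far F f"
| "interp_ar T' F B \<phi> (Prime f) = \<phi> f"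
| "interp_ar T' F B \<phi> (RId X) = Idt T' (interp_ob T' F B X)"
| "interp_ar T' F B \<phi> (RCmp t s) = Cmp T' (interp_ar T' F B \<phi> t) (interp_ar T' F B \<phi> s)"
| "interp_ar T' F B \<phi> (RPrj Ys i) = Prj T' (map (interp_ob T' F B) Ys) i"
| "interp_ar T' F B \<phi> (RTup X ts) = tuple T' (interp_ob T' F B X) (map (interp_ar T' F B \<phi>) ts)"

locale interp = decorated_theory T P + T': equational_theory T' for T P T' +
  fixes F B \<phi>
  assumes D: "Fexp_data T P T' F B \<phi>"
begin

abbreviation "J0 \<equiv> interp_ob T' F B"
abbreviation "J \<equiv> interp_ar T' F B \<phi>"

lemma F: "theory_morphism (pure_theory T P) T' F" using D by (simp add: Fexp_data_def)

lemma pure_simps [simp]: "Ob (pure_theory T P) = Ob T" "Ar (pure_theory T P) = P"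
  "Dom (pure_theory T P) = Dom T" "Cod (pure_theory T P) = Cod T" "Idt (pure_theory T P) = Idt T"
  "Cmp (pure_theory T P) = Cmp T" "Prd (pure_theory T P) = Prd T" "Prj (pure_theory T P) = Prj T"
  by (auto simp: pure_theory_def)

lemma J0_aprod: "set Ys \<subseteq> atypes T \<Longrightarrow> J0 (aprod T Ys) = Prd T' (map J0 Ys)"
proof (cases "list_all is_Base Ys")
  case True
  assume Ys: "set Ys \<subseteq> atypes T"
  have "set (map the_Base Ys) \<subseteq> Ob T" using Ys True Base_in_atypes by (force simp: list_all_iff)
  then have "J0 (aprod T Ys) = Prd T' (map (fob F) (map the_Base Ys))"
    using theory_morphism_Prd[OF F] True by (simp add: aprod_def)
  also have "map (fob F) (map the_Base Ys) = map J0 Ys"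
    using True by (auto simp: list_all_iff is_Base_def)
  finally show ?thesis .
qed (auto simp: aprod_def)

lemma J0_in: "Z \<in> atypes T \<Longrightarrow> J0 Z \<in> Ob T'"
proof (induction rule: atypes.induct)
  case (atypes_Base X) then show ?case using theory_morphism_Ob[OF F] by simp
next
  case atypes_Param then show ?case using D by (simp add: Fexp_data_def)
next
  case (atypes_aprod Zs)
  then show ?case by (subst J0_aprod) (auto intro!: T'.Prd_in)
qed

lemma tuple_sound:
  assumes X: "X \<in> atypes T" and l: "list_all2 (\<lambda>Y t. Y \<in> atypes T \<and> J t \<in> hom T' (J0 X) (J0 Y)) Ys ts"
  shows "is_tuple T' (J0 X) (map J ts) h \<longleftrightarrow> h = tuple T' (J0 X) (map J ts)"
    and "tuple T' (J0 X) (map J ts) \<in> hom T' (J0 X) (J0 (aprod T Ys))"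
    and "map (Cod T') (map J ts) = map J0 Ys"
proof -
  have Ys: "set Ys \<subseteq> atypes T" using l by (auto simp: list_all2_conv_all_nth in_set_conv_nth)
  show c: "map (Cod T') (map J ts) = map J0 Ys"
    using l by (auto simp: list_all2_conv_all_nth hom_iff intro!: nth_equalityI)
  have fs: "set (map J ts) \<subseteq> Ar T'" "\<And>f. f \<in> set (map J ts) \<Longrightarrow> Dom T' f = J0 X"
    using l by (auto simp: list_all2_conv_all_nth hom_iff in_set_conv_nth)
  note e = T'.is_tuple_tuple[OF J0_in[OF X] fs]
  show "is_tuple T' (J0 X) (map J ts) h \<longleftrightarrow> h = tuple T' (J0 X) (map J ts)"
    using e T'.tuple_eqI[OF J0_in[OF X] fs] by metis
  show "tuple T' (J0 X) (map J ts) \<in> hom T' (J0 X) (J0 (aprod T Ys))"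
    using e unfolding is_tuple_def c by (simp add: J0_aprod[OF Ys])
qed

lemma J0_pair: "X \<in> Ob T \<Longrightarrow> J0 (aprod T [Param, Base X]) = Prd T' [B, fob F X]"
  by (subst J0_aprod) (auto intro: atypes.intros)

lemma J_typed: "ty X Y t \<Longrightarrow> J t \<in> hom T' (J0 X) (J0 Y)"
proof (induction rule: typed.induct)
  case (typed_Pure f)
  then show ?case using theory_morphism_hom[OF F, of f] by (auto simp: hom_iff)
next
  case (typed_Prime f)
  then show ?case using D J0_pair[OF Dom_in] by (simp add: Fexp_data_def)
next
  case (typed_RId X) then show ?case by (auto intro: T'.Idt_hom J0_in)
next
  case (typed_RCmp Y Z t X s) then show ?case by (auto intro: T'.Cmp_hom)
next
  case (typed_RPrj Ys i)
  have "Prj T' (map J0 Ys) i \<in> hom T' (Prd T' (map J0 Ys)) (map J0 Ys ! i)"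
    using typed_RPrj by (intro T'.Prj_hom) (auto intro: J0_in)
  then show ?case using typed_RPrj J0_aprod by simp
next
  case (typed_RTup X Ys ts)
  then have "list_all2 (\<lambda>Y t. Y \<in> atypes T \<and> J t \<in> hom T' (J0 X) (J0 Y)) Ys ts"
    using typed_in by (auto simp: list_all2_conv_all_nth)
  from tuple_sound(2)[OF typed_RTup(1) this] show ?case by simp
qed

lemma typed_list: "list_all2 (ty X) Ys ts \<Longrightarrow>
    list_all2 (\<lambda>Y t. Y \<in> atypes T \<and> J t \<in> hom T' (J0 X) (J0 Y)) Ys ts"
  by (erule list_all2_mono) (use typed_in J_typed in blast)

lemma J_sound: "eqr X Y t s \<Longrightarrow> J t = J s"
proof (induction rule: equiv_raw.induct)
  case (eq_RTup X ts Ys ts')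
  then have "map J ts = map J ts'" by (auto intro: nth_equalityI)
  then show ?case by simp
next
  case (eq_id_left X Y t) then show ?case using T'.Cmp_Idt_left[OF J_typed] by auto
next
  case (eq_id_right X Y t) then show ?case using T'.Cmp_Idt_right[OF J_typed] by auto
next
  case (eq_assoc W X r Y s Z t) then show ?case using T'.Cmp_assoc[OF J_typed J_typed J_typed] by auto
next
  case (eq_beta X Ys ts i)
  note l = typed_list[OF eq_beta(2)]
  have "is_tuple T' (J0 X) (map J ts) (tuple T' (J0 X) (map J ts))"
    using tuple_sound(1)[OF eq_beta(1) l] by simp
  then show ?case using eq_beta(2,3) unfolding is_tuple_def tuple_sound(3)[OF eq_beta(1) l]
    by (auto simp: list_all2_conv_all_nth)
next
  case (eq_eta Ys X t)
  let ?ts = "map (\<lambda>i. RCmp (RPrj Ys i) t) [0..<length Ys]"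
  have X: "X \<in> atypes T" using typed_in[OF eq_eta(2)] by simp
  have "list_all2 (ty X) Ys ?ts"
    using eq_eta by (auto intro!: typed_RCmp typed_RPrj simp: list_all2_conv_all_nth)
  note l = typed_list[OF this]
  have "is_tuple T' (J0 X) (map J ?ts) (J t)"
    unfolding is_tuple_def tuple_sound(3)[OF X l]
    using J_typed[OF eq_eta(2)] J0_aprod[OF eq_eta(1)] by simp
  then show ?case using tuple_sound(1)[OF X l] by simp
next
  case (eq_Pure_Idt X) then show ?case using theory_morphism_Idt[OF F] by simp
next
  case (eq_Pure_Cmp f g)
  then show ?case using theory_morphism_Cmp[OF F, of f "Dom T f" "Cod T f" g "Cod T g"]
    by (simp add: hom_iff)
next
  case (eq_Pure_Prj Xs i)
  then show ?case using theory_morphism_Prj[OF F, of Xs i] by (simp add: comp_def)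
next
  case (eq_Prime_pure f) then show ?case using D by (simp add: Fexp_data_def)
next
  case (eq_Prime_Cmp f g) then show ?case using D J0_pair[OF Dom_in] by (simp add: Fexp_data_def)
next
  case (eq_Prime_tuple X fs)
  then show ?case using D J0_pair[of X] by (auto simp add: Fexp_data_def comp_def)
qed auto

definition G where
  "G = \<lparr>fob = (\<lambda>X \<in> atypes T. J0 X), far = (\<lambda>a \<in> Ar E. J (SOME t. t \<in> snd (snd a)))\<rparr>"

lemma G_aterm: assumes "ty X Y t" shows "far G (aterm T P X Y t) = J t"
proof -
  have "t \<in> snd (snd (aterm T P X Y t))" using assms by (auto simp: aterm_def intro: eq_refl)
  then have "(SOME s. s \<in> snd (snd (aterm T P X Y t))) \<in> snd (snd (aterm T P X Y t))"
    by (rule someI)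
  then have "eqr X Y t (SOME s. s \<in> snd (snd (aterm T P X Y t)))" by (auto simp: aterm_def)
  moreover have "aterm T P X Y t \<in> Ar E" using assms by (auto simp: Fexp_Ar_iff)
  ultimately show ?thesis using J_sound by (simp add: G_def)
qed

lemma G_morphism: "theory_morphism E T' G"
proof -
  have 0: "fob G X = J0 X" if "X \<in> atypes T" for X using that by (simp add: G_def)
  have a: "far G a \<in> hom T' (fob G X) (fob G Y)" if "a \<in> hom E X Y" for a X Y
  proof -
    obtain t where t: "ty X Y t" "a = aterm T P X Y t" using \<open>a \<in> hom E X Y\<close> by (auto simp: Fexp_hom_iff)
    show ?thesis using G_aterm[OF t(1)] J_typed[OF t(1)] typed_in[OF t(1)] t(2) 0 by simp
  qed
  show ?thesis unfolding theory_morphism_def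
  proof (intro conjI ballI allI impI)
    show "fob G \<in> Ob E \<rightarrow>\<^sub>E Ob T'" by (auto simp: G_def J0_in)
    have "far G f \<in> Ar T'" if "f \<in> Ar E" for f using that a[of f "Dom E f" "Cod E f"] by (auto simp: hom_iff)
    then show "far G \<in> Ar E \<rightarrow>\<^sub>E Ar T'" by (auto simp: G_def)
  next
    fix f assume "f \<in> Ar E"
    then show "Dom T' (far G f) = fob G (Dom E f)" "Cod T' (far G f) = fob G (Cod E f)"
      using a[of f "Dom E f" "Cod E f"] by (auto simp: hom_iff)
  next
    fix X assume X: "X \<in> Ob E"
    then show "far G (Idt E X) = Idt T' (fob G X)" using G_aterm[OF typed_RId[of X T P]] 0 by simp
  next
    fix f g assume "f \<in> Ar E" "g \<in> Ar E" "Cod E f = Dom E g"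
    then obtain X Y Z s t where s: "ty X Y s" "f = aterm T P X Y s" and t: "ty Y Z t" "g = aterm T P Y Z t"
      by (auto simp: Fexp_Ar_iff)
    show "far G (Cmp E g f) = Cmp T' (far G g) (far G f)"
      by (simp add: s t Cmp_aterm[OF t(1) s(1)] G_aterm[OF typed_RCmp[OF t(1) s(1)]] G_aterm[OF s(1)] G_aterm[OF t(1)])
  next
    fix Xs assume Xs: "set Xs \<subseteq> Ob E"
    have m: "map (fob G) Xs = map J0 Xs" using Xs 0 by auto
    then show "fob G (Prd E Xs) = Prd T' (map (fob G) Xs)"
      using Xs J0_aprod[of Xs] 0[OF aprod_in, of Xs] by (simp del: map_eq_conv)
    fix i assume "i < length Xs"
    then show "far G (Prj E Xs i) = Prj T' (map (fob G) Xs) i"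
      using Xs G_aterm[OF typed_RPrj[of Xs T i P]] unfolding m by simp
  qed
qed

lemma G_unique:
  assumes H: "theory_morphism E T' H"
    and HF: "fcomp (pure_theory T P) H (Fexp_incl T P) = F" and HB: "fob H Param = B"
    and H\<phi>: "(\<lambda>f \<in> Ar T. far H (prime_term T P f)) = \<phi>"
  shows "H = G"
proof -
  have Hb: "fob H (Base X) = fob F X" if "X \<in> Ob T" for X
    using that HF by (auto simp: fcomp_def Fexp_incl_def compose_def)
  have 0: "X \<in> atypes T \<Longrightarrow> fob H X = J0 X" for X
  proof (induction rule: atypes.induct)
    case (atypes_aprod Zs)
    then have Zs: "set Zs \<subseteq> atypes T" and m: "map (fob H) Zs = map J0 Zs" by auto
    show ?case using theory_morphism_Prd[OF H, of Zs] J0_aprod[OF Zs] Zs m by simp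
  qed (auto simp: Hb HB)
  have 1: "ty X Y t \<Longrightarrow> far H (aterm T P X Y t) = J t" for X Y t
  proof (induction rule: typed.induct)
    case (typed_Pure f)
    then show ?case using HF by (auto simp: fcomp_def Fexp_incl_def compose_def)
  next
    case (typed_Prime f)
    then show ?case using H\<phi> by (auto simp: prime_term_def)
  next
    case (typed_RId X) then show ?case using theory_morphism_Idt[OF H, of X] 0 by simp
  next
    case (typed_RCmp Y Z t X s)
    then show ?case
      using theory_morphism_Cmp[OF H, of "aterm T P X Y s" X Y "aterm T P Y Z t" Z] Cmp_aterm[of Y Z t X s]
      by (auto simp: Fexp_hom_iff)
  next
    case (typed_RPrj Ys i)
    moreover have "map (fob H) Ys = map J0 Ys" using typed_RPrj 0 by auto
    ultimately show ?case using theory_morphism_Prj[OF H, of Ys i] by (simp del: map_eq_conv)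
  next
    case (typed_RTup X Ys ts)
    have l: "list_all2 (ty X) Ys ts" by (rule list_all2_mono[OF typed_RTup(2)]) simp
    have "is_tuple E X (map2 (aterm T P X) Ys ts) (aterm T P X (aprod T Ys) (RTup X ts))"
      using aterm_is_tuple[OF typed_RTup(1) l] by simp
    moreover have "set (map2 (aterm T P X) Ys ts) \<subseteq> Ar E"
      using l by (fastforce simp: Fexp_Ar_iff set_zip list_all2_conv_all_nth simp del: split_paired_Ex split_paired_All)
    moreover have d: "Dom E f = X" if "f \<in> set (map2 (aterm T P X) Ys ts)" for f
      using that by auto
    moreover have "map (far H) (map2 (aterm T P X) Ys ts) = map J ts"
      using typed_RTup(2) by (auto simp: list_all2_conv_all_nth intro!: nth_equalityI)
    ultimately have "is_tuple T' (J0 X) (map J ts) (far H (aterm T P X (aprod T Ys) (RTup X ts)))"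
      using theory_morphism_tuple[OF Fexp_theory H, of "map2 (aterm T P X) Ys ts" X] 0[OF typed_RTup(1)] by metis
    then show ?case using tuple_sound(1)[OF typed_RTup(1) typed_list[OF l]] by simp
  qed
  have "fob H = fob G"
  proof (rule extensionalityI[where A="Ob E"])
    show "fob H \<in> extensional (Ob E)" "fob G \<in> extensional (Ob E)"
      using H G_morphism by (auto simp only: theory_morphism_def PiE_def Int_iff)
  qed (simp add: 0 G_def)
  moreover have "far H = far G"
  proof (rule extensionalityI[where A="Ar E"])
    show "far H \<in> extensional (Ar E)" "far G \<in> extensional (Ar E)"
      using H G_morphism by (auto simp only: theory_morphism_def PiE_def Int_iff)
  next
    fix a assume "a \<in> Ar E" then show "far H a = far G a" using 1 G_aterm unfolding Fexp_Ar_iff by metis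
  qed
  ultimately show ?thesis by simp
qed

lemma G_data:
  "fcomp (pure_theory T P) G (Fexp_incl T P) = F"
  "fob G Param = B"
  "(\<lambda>f \<in> Ar T. far G (prime_term T P f)) = \<phi>"
proof -
  have f: "fob F \<in> extensional (Ob T)" "far F \<in> extensional P"
    using F by (auto simp: theory_morphism_def PiE_def)
  have "compose (Ob T) (fob G) (fob (Fexp_incl T P)) = fob F"
    using f by (intro extensionalityI[where A="Ob T"]) (auto simp: compose_def Fexp_incl_def G_def atypes_Base)
  moreover have "compose P (far G) (far (Fexp_incl T P)) = far F"
    using f by (intro extensionalityI[where A="P"])
      (auto simp: compose_def Fexp_incl_def G_aterm[OF typed_Pure])
  ultimately show "fcomp (pure_theory T P) G (Fexp_incl T P) = F" by (simp add: fcomp_def)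
  show "fob G Param = B" by (simp add: G_def atypes_Param)
  show "(\<lambda>f \<in> Ar T. far G (prime_term T P f)) = \<phi>"
    using D by (intro extensionalityI[where A="Ar T"])
      (auto simp: Fexp_data_def prime_term_def G_aterm[OF typed_Prime])
qed

end


context decorated_theory begin

lemma tuple_aterm:
  assumes "X \<in> atypes T" "list_all2 (ty X) Ys ts"
  shows "tuple E X (map2 (aterm T P X) Ys ts) = aterm T P X (aprod T Ys) (RTup X ts)"
  unfolding tuple_def aterm_is_tuple[OF assms] by simp

theorem Fexp_data_Fexp:
  "Fexp_data T P E (Fexp_incl T P) Param (\<lambda>f \<in> Ar T. prime_term T P f)"
proof -
  have p: "Ob (pure_theory T P) = Ob T" "Ar (pure_theory T P) = P"
    "Dom (pure_theory T P) = Dom T" "Cod (pure_theory T P) = Cod T" "Idt (pure_theory T P) = Idt T"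
    "Cmp (pure_theory T P) = Cmp T" "Prd (pure_theory T P) = Prd T" "Prj (pure_theory T P) = Prj T"
    by (auto simp: pure_theory_def)
  have b: "fob (Fexp_incl T P) X = Base X" if "X \<in> Ob T" for X
    using that by (simp add: Fexp_incl_def)
  have a: "far (Fexp_incl T P) f = aterm T P (Base (Dom T f)) (Base (Cod T f)) (Pure f)" if "f \<in> P" for f
    using that by (simp add: Fexp_incl_def)
  have mb: "map (fob (Fexp_incl T P)) Xs = map Base Xs" if "set Xs \<subseteq> Ob T" for Xs
    using that b by auto
  have 1: "theory_morphism (pure_theory T P) E (Fexp_incl T P)"
    unfolding theory_morphism_def p
  proof (intro conjI ballI allI impI)
    show "fob (Fexp_incl T P) \<in> Ob T \<rightarrow>\<^sub>E Ob E" by (auto simp: Fexp_incl_def intro: atypes.intros)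
    have "aterm T P (Base (Dom T f)) (Base (Cod T f)) (Pure f) \<in> Ar E" if "f \<in> P" for f
      using typed_Pure[OF that] unfolding Fexp_Ar_iff by blast
    then show "far (Fexp_incl T P) \<in> P \<rightarrow>\<^sub>E Ar E" by (auto simp: Fexp_incl_def)
  next
    fix f assume f: "f \<in> P"
    then have "Dom T f \<in> Ob T" "Cod T f \<in> Ob T" using pure_Ar Dom_in Cod_in by auto
    then show "Dom E (far (Fexp_incl T P) f) = fob (Fexp_incl T P) (Dom T f)"
      "Cod E (far (Fexp_incl T P) f) = fob (Fexp_incl T P) (Cod T f)"
      using f by (simp_all add: a b)
  next
    fix X assume X: "X \<in> Ob T"
    then have "Dom T (Idt T X) = X" "Cod T (Idt T X) = X" using Idt_hom by (auto simp: hom_iff)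
    then show "far (Fexp_incl T P) (Idt T X) = Idt E (fob (Fexp_incl T P) X)"
      using equiv_typed[OF eq_Pure_Idt[OF X]] eq_Pure_Idt[OF X] X
      by (simp add: a b pure_Idt aterm_eq_iff)
  next
    fix f g assume fg: "f \<in> P" "g \<in> P" "Cod T f = Dom T g"
    then have "Cmp T g f \<in> hom T (Dom T f) (Cod T g)" using pure_Ar by (intro Cmp_hom) (auto simp: hom_iff)
    then have "Dom T (Cmp T g f) = Dom T f" "Cod T (Cmp T g f) = Cod T g" by (auto simp: hom_iff)
    then show "far (Fexp_incl T P) (Cmp T g f) = Cmp E (far (Fexp_incl T P) g) (far (Fexp_incl T P) f)"
      using equiv_typed[OF eq_Pure_Cmp[OF fg]] eq_Pure_Cmp[OF fg] fg pure_Cmp[OF fg]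
        Cmp_aterm[OF typed_Pure[OF fg(2)] typed_Pure[OF fg(1), of T, unfolded fg(3)]]
      by (simp add: a aterm_eq_iff)
  next
    fix Xs assume Xs: "set Xs \<subseteq> Ob T"
    show "fob (Fexp_incl T P) (Prd T Xs) = Prd E (map (fob (Fexp_incl T P)) Xs)"
      unfolding mb[OF Xs] using Prd_in[OF Xs] by (simp add: b)
    fix i assume i: "i < length Xs"
    have "Dom T (Prj T Xs i) = Prd T Xs" "Cod T (Prj T Xs i) = Xs ! i"
      using Prj_hom[OF Xs i] by (auto simp: hom_iff)
    then show "far (Fexp_incl T P) (Prj T Xs i) = Prj E (map (fob (Fexp_incl T P)) Xs) i"
      unfolding mb[OF Xs]
      using equiv_typed[OF eq_Pure_Prj[OF Xs i]] eq_Pure_Prj[OF Xs i] i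
      by (simp add: a pure_Prj[OF Xs i] aterm_eq_iff)
  qed
  have pr: "prime_term T P f \<in> hom E (aprod T [Param, Base (Dom T f)]) (Base (Cod T f))" if "f \<in> Ar T" for f
    using typed_Prime[OF that] by (auto simp: prime_term_def Fexp_hom_iff)
  have 2: "prime_term T P f = Cmp E (far (Fexp_incl T P) f) (Prj E [Param, Base (Dom T f)] 1)" if f: "f \<in> P" for f
  proof -
    have "Dom T f \<in> Ob T" using f pure_Ar Dom_in by auto
    then show ?thesis
      using equiv_typed[OF eq_Prime_pure[OF f]] eq_Prime_pure[OF f]
        Cmp_aterm[OF typed_Pure[OF f] Prj_typed(2)]
      by (simp add: prime_term_def a[OF f] aterm_eq_iff)
  qed
  have 3: "prime_term T P (Cmp T g f) = Cmp E (prime_term T P g)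
      (tuple E (aprod T [Param, Base (Dom T f)]) [Prj E [Param, Base (Dom T f)] 0, prime_term T P f])"
    if fg: "f \<in> Ar T" "g \<in> Ar T" "Cod T f = Dom T g" for f g
  proof -
    let ?X = "aprod T [Param, Base (Dom T f)]"
    have d: "Dom T (Cmp T g f) = Dom T f" "Cod T (Cmp T g f) = Cod T g"
      using Cmp_hom[of f "Dom T f" "Cod T f" g "Cod T g"] fg by (auto simp: hom_iff)
    have X: "?X \<in> atypes T" using Dom_in fg by (auto intro!: aprod_in atypes.intros)
    have l: "list_all2 (ty ?X) [Param, Base (Cod T f)] [RPrj [Param, Base (Dom T f)] 0, Prime f]"
      using fg by (auto intro!: Prj_typed Dom_in Prime_hom simp: hom_iff)
    have t: "tuple E ?X [Prj E [Param, Base (Dom T f)] 0, prime_term T P f] =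
      aterm T P ?X (aprod T [Param, Base (Dom T g)]) (RTup ?X [RPrj [Param, Base (Dom T f)] 0, Prime f])"
      using tuple_aterm[OF X l] fg by (simp add: prime_term_def)
    show ?thesis unfolding t
      using equiv_typed[OF eq_Prime_Cmp[OF fg]] eq_Prime_Cmp[OF fg]
        Cmp_aterm[OF typed_Prime[OF fg(2)] typed_RTup[OF X l, unfolded fg(3)]]
      by (simp add: prime_term_def d aterm_eq_iff)
  qed
  have 4: "prime_term T P (tuple T X fs) = tuple E (aprod T [Param, Base X]) (map (prime_term T P) fs)"
    if X: "X \<in> Ob T" and fs: "set fs \<subseteq> Ar T" "\<And>f. f \<in> set fs \<Longrightarrow> Dom T f = X" for X fs
  proof -
    let ?X = "aprod T [Param, Base X]"
    have "tuple T X fs \<in> hom T X (Prd T (map (Cod T) fs))"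
      using is_tuple_tuple[OF X fs] by (simp add: is_tuple_def)
    then have d: "Dom T (tuple T X fs) = X" "Cod T (tuple T X fs) = Prd T (map (Cod T) fs)"
      by (auto simp: hom_iff)
    have aX: "?X \<in> atypes T" using X by (auto intro!: aprod_in atypes.intros)
    have l: "list_all2 (ty ?X) (map Base (map (Cod T) fs)) (map Prime fs)"
      using fs by (auto simp: list_all2_conv_all_nth hom_iff subset_iff intro!: Prime_hom)
    have m: "map (prime_term T P) fs = map2 (aterm T P ?X) (map Base (map (Cod T) fs)) (map Prime fs)"
      using fs by (auto simp: prime_term_def intro!: nth_equalityI)
    show ?thesis unfolding m tuple_aterm[OF aX l]
      using equiv_typed[OF eq_Prime_tuple[OF X fs]] eq_Prime_tuple[OF X fs]
      by (simp add: prime_term_def d aterm_eq_iff del: map_map)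
  qed
  have c: "Cmp T g f \<in> Ar T" if "f \<in> Ar T" "g \<in> Ar T" "Cod T f = Dom T g" for f g
    using Cmp_hom[of f "Dom T f" "Cod T f" g "Cod T g"] that by (auto simp: hom_iff)
  have t: "tuple T X fs \<in> Ar T" if "X \<in> Ob T" "set fs \<subseteq> Ar T" "\<And>f. f \<in> set fs \<Longrightarrow> Dom T f = X" for X fs
    using is_tuple_tuple[OF that] by (simp add: is_tuple_def hom_iff)
  show ?thesis unfolding Fexp_data_def
  proof (intro conjI ballI allI impI)
    fix X fs assume fs: "X \<in> Ob T" "set fs \<subseteq> Ar T" "\<forall>f \<in> set fs. Dom T f = X"
    have "map (\<lambda>f \<in> Ar T. prime_term T P f) fs = map (prime_term T P) fs" using fs by auto
    then show "(\<lambda>f \<in> Ar T. prime_term T P f) (tuple T X fs) =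
        tuple E (Prd E [Param, fob (Fexp_incl T P) X]) (map (\<lambda>f \<in> Ar T. prime_term T P f) fs)"
      using fs 4[of X fs] t[of X fs] by (simp add: b del: map_eq_conv)
  qed (use 1 pr 2 3 c pure_Ar Dom_in Cod_in in \<open>auto simp: b atypes_Param subset_iff simp del: Fexp_simps(3,4)\<close>)
qed

end

theorem Fexp_universal:
  assumes "decorated_theory T P" "equational_theory T'" "Fexp_data T P T' F B \<phi>"
  shows "\<exists>!H. theory_morphism (Fexp T P) T' H \<and> fcomp (pure_theory T P) H (Fexp_incl T P) = F \<and>
    fob H Param = B \<and> (\<lambda>f \<in> Ar T. far H (prime_term T P f)) = \<phi>"
proof -
  interpret interp T P T' F B \<phi> using assms by (simp add: interp_def interp_axioms_def)
  show ?thesis using G_morphism G_data G_unique by (intro ex1I[of _ G]) blast+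
qed

end

theory Submission
  imports Defs
begin

text \<open>
  A model of \<open>F\<^sub>e\<^sub>x\<^sub>p T\<close> over \<open>M\<^sub>0\<close> is a set \<open>B\<close> interpreting the parameter type together with maps
  \<open>B \<times> M\<^sub>0 X \<rightarrow> M\<^sub>0 Y\<close> that satisfy the three relations; a morphism of such models is a map between the
  parameter sets compatible with these maps. A model \<open>N\<close> of \<open>T\<close> over \<open>M\<^sub>0\<close> is thus the same as a
  model of \<open>F\<^sub>e\<^sub>x\<^sub>p T\<close> over \<open>M\<^sub>0\<close> whose parameter set is a singleton \<open>{u}\<close>, and a morphism from that model
  to \<open>M\<^sub>A\<close> is an element \<open>\<alpha>\<close> of \<open>M\<^sub>A A\<close> (the image of \<open>u\<close>) with \<open>M\<^sub>A\<^sub>,\<^sub>\<alpha> = N\<close>. By terminality there is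
  exactly one such \<open>\<alpha>\<close>.
\<close>

section \<open>Pure subtheories, tuples of sets and precomposition\<close>

lemma pure_theory_simps [simp]: "Ob (pure_theory T P) = Ob T" "Ar (pure_theory T P) = P"
  "Dom (pure_theory T P) = Dom T" "Cod (pure_theory T P) = Cod T" "Idt (pure_theory T P) = Idt T"
  "Cmp (pure_theory T P) = Cmp T" "Prd (pure_theory T P) = Prd T" "Prj (pure_theory T P) = Prj T"
  by (auto simp: pure_theory_def)

lemma cart_cases:
  assumes "t \<in> cart Ss"
  obtains xs where "t = tup xs" "list_all2 (\<in>) xs Ss" "length xs = length Ss"
  using assms by (auto simp: cart_def dest: list_all2_lengthD)

lemma tup_in_cart: "list_all2 (\<in>) xs Ss \<Longrightarrow> tup xs \<in> cart Ss"
  by (auto simp: cart_def)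

lemma app_Prj_Sets:
  assumes "list_all2 (\<in>) xs Ss"
  shows "app (Prj Sets Ss i) (tup xs) = xs ! i"
  using assms components_tup[of xs] by (simp add: tup_in_cart list_all2_lengthD)

text \<open>The value \<open>app h x\<close> lies in a cartesian product, so it is
  \<open>tup xs\<close> for some list \<open>xs\<close>; the projection equations satisfied by
  \<open>h\<close> determine each entry of \<open>xs\<close>.\<close>

lemma app_tuple_Sets:
  assumes h: "is_tuple Sets S fs h" and x: "x \<in> S"
  shows "app h x = tup (map (\<lambda>f. app f x) fs)"
proof -
  have hh: "src h = S" "app h x \<in> cart (map tgt fs)"
    using h x by (auto simp: is_tuple_def Sets_hom_iff)
  obtain xs where xs: "app h x = tup xs" "list_all2 (\<in>) xs (map tgt fs)" "length xs = length fs"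
    using cart_cases[OF hh(2)] by auto
  have "xs ! i = app (fs ! i) x" if i: "i < length fs" for i
  proof -
    have "fs ! i = Cmp Sets (Prj Sets (map tgt fs) i) h" using h i by (simp add: is_tuple_def)
    then have "app (fs ! i) x = app (Prj Sets (map tgt fs) i) (app h x)"
      using hh x by (simp add: compose_def)
    then show ?thesis by (simp only: xs(1) app_Prj_Sets[OF xs(2)])
  qed
  then have "xs = map (\<lambda>f. app f x) fs" using xs(3) by (auto intro: nth_equalityI)
  then show ?thesis using xs by simp
qed

text \<open>Associativity moves \<open>k\<close> past each projection. Applied below with
  \<open>k\<close> the projection that forgets the parameter.\<close>

lemma (in equational_theory) is_tuple_precomp:
  assumes k: "k \<in> hom T W X" and X: "X \<in> Ob T"
    and fs: "set fs \<subseteq> Ar T" "\<And>f. f \<in> set fs \<Longrightarrow> Dom T f = X" and h: "is_tuple T X fs h"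
  shows "is_tuple T W (map (\<lambda>f. Cmp T f k) fs) (Cmp T h k)"
proof -
  have c: "map (Cod T) (map (\<lambda>f. Cmp T f k) fs) = map (Cod T) fs"
    using Cmp_hom[OF k] fs by (auto simp: hom_iff)
  have Ys: "set (map (Cod T) fs) \<subseteq> Ob T" using fs Cod_in by auto
  have hh: "h \<in> hom T X (Prd T (map (Cod T) fs))" using h by (simp add: is_tuple_def)
  show ?thesis unfolding is_tuple_def c
  proof (intro conjI allI impI)
    show "Cmp T h k \<in> hom T W (Prd T (map (Cod T) fs))" by (rule Cmp_hom[OF k hh])
    fix i assume i: "i < length (map (\<lambda>f. Cmp T f k) fs)"
    have "Prj T (map (Cod T) fs) i \<in> hom T (Prd T (map (Cod T) fs)) (map (Cod T) fs ! i)"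
      using i by (intro Prj_hom[OF Ys]) simp
    from Cmp_assoc[OF k hh this]
    show "Cmp T (Prj T (map (Cod T) fs) i) (Cmp T h k) = map (\<lambda>f. Cmp T f k) fs ! i"
      using h i by (simp add: is_tuple_def)
  qed
qed

section \<open>Morphisms extending a given one on the pure subtheory\<close>

lemma over_pure_iff:
  assumes F: "theory_morphism (pure_theory T P) T' F"
  shows "fcomp (pure_theory T P) N (pure_incl T P) = F \<longleftrightarrow>
    (\<forall>X \<in> Ob T. fob N X = fob F X) \<and> (\<forall>f \<in> P. far N f = far F f)"
proof -
  \<comment> \<open>A composite of functors is \<open>undefined\<close> outside its source. Since
    \<open>F\<close> is extensional too, agreement on \<open>Ob T\<close> and on \<open>P\<close>
    amounts to equality.\<close>
  have e: "fob F \<in> extensional (Ob T)" "far F \<in> extensional P"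
    using F by (auto simp: theory_morphism_def PiE_def)
  have "compose (Ob T) (fob N) (fob (pure_incl T P)) = fob F \<longleftrightarrow> (\<forall>X \<in> Ob T. fob N X = fob F X)"
    using e(1) by (force simp: compose_def pure_incl_def extensional_def fun_eq_iff)
  moreover have "compose P (far N) (far (pure_incl T P)) = far F \<longleftrightarrow> (\<forall>f \<in> P. far N f = far F f)"
    using e(2) by (force simp: compose_def pure_incl_def extensional_def fun_eq_iff)
  ultimately show ?thesis by (cases F) (simp add: fcomp_def)
qed

text \<open>A morphism \<open>N\<close> on \<open>T\<close> extends to \<open>F\<^sub>e\<^sub>x\<^sub>p T\<close> for any choice of the parameter type, by ignoring it.\<close>

lemma Fexp_data_const:
  assumes dec: "decorated_theory T P" and T': "equational_theory T'"
    and F: "theory_morphism (pure_theory T P) T' F" and N: "theory_morphism T T' N"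
    and NF: "fcomp (pure_theory T P) N (pure_incl T P) = F" and B: "B \<in> Ob T'"
  shows "Fexp_data T P T' F B (\<lambda>f \<in> Ar T. Cmp T' (far N f) (Prj T' [B, fob F (Dom T f)] 1))"
proof -
  interpret decorated_theory T P by fact
  interpret T': equational_theory T' by fact
  have ob: "fob F X = fob N X" if "X \<in> Ob T" for X
    using NF that unfolding over_pure_iff[OF F] by simp
  have ar: "far F f = far N f" if "f \<in> P" for f
    using NF that unfolding over_pure_iff[OF F] by simp
  have in': "fob N X \<in> Ob T'" if "X \<in> Ob T" for X using theory_morphism_Ob[OF N that] .
  \<comment> \<open>\<open>W X\<close> plays the role of the product A x X in \<open>T'\<close>,
    with projections \<open>pr X\<close> to the parameter and \<open>ep X\<close> to
    \<open>X\<close>; the candidate for \<open>f'\<close> is \<open>far N f\<close> after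
    \<open>ep (Dom T f)\<close>.\<close>
  define pr where "pr X = Prj T' [B, fob F X] 0" for X
  define ep where "ep X = Prj T' [B, fob F X] 1" for X
  define W where "W X = Prd T' [B, fob F X]" for X
  have W: "W X \<in> Ob T'" if "X \<in> Ob T" for X
    using that B in' ob by (simp add: W_def T'.Prd_in)
  have pr: "pr X \<in> hom T' (W X) B" if "X \<in> Ob T" for X
    using T'.Prj_hom[of "[B, fob F X]" 0] that B in' ob by (simp add: W_def pr_def)
  have ep: "ep X \<in> hom T' (W X) (fob N X)" if "X \<in> Ob T" for X
    using T'.Prj_hom[of "[B, fob F X]" 1] that B in' ob by (simp add: W_def ep_def)
  have far: "far N f \<in> hom T' (fob N (Dom T f)) (fob N (Cod T f))" if "f \<in> Ar T" for f
    using theory_morphism_hom[OF N, of f "Dom T f" "Cod T f"] that by (simp add: hom_iff)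
  have phi: "Cmp T' (far N f) (ep (Dom T f)) \<in> hom T' (W (Dom T f)) (fob N (Cod T f))"
    if "f \<in> Ar T" for f
    using T'.Cmp_hom[OF ep far] that Dom_in by simp
  have comp: "Cmp T' (far N (Cmp T g f)) (ep (Dom T f)) =
      Cmp T' (Cmp T' (far N g) (ep (Dom T g)))
        (tuple T' (W (Dom T f)) [pr (Dom T f), Cmp T' (far N f) (ep (Dom T f))])"
    if fg: "f \<in> Ar T" "g \<in> Ar T" "Cod T f = Dom T g" for f g
  proof -
    let ?fs = "[pr (Dom T f), Cmp T' (far N f) (ep (Dom T f))]"
    let ?k = "tuple T' (W (Dom T f)) ?fs"
    note d = Dom_in[OF fg(1)] Cod_in[OF fg(1)]
    have c: "map (Cod T') ?fs = [B, fob F (Dom T g)]"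
      using pr[OF d(1)] phi[OF fg(1)] fg ob[OF d(2)] by (simp add: hom_iff)
    have k: "is_tuple T' (W (Dom T f)) ?fs ?k"
      using pr[OF d(1)] phi[OF fg(1)] W[OF d(1)] by (intro T'.is_tuple_tuple) (auto simp: hom_iff)
    then have "\<forall>i < length ?fs. Cmp T' (Prj T' [B, fob F (Dom T g)] i) ?k = ?fs ! i"
      and kh: "?k \<in> hom T' (W (Dom T f)) (W (Dom T g))"
      unfolding is_tuple_def c W_def by blast+
    \<comment> \<open>Index 1 selects the second component of \<open>?k\<close>, so composing with
      \<open>ep (Dom T g)\<close> discards the parameter and only functoriality of \<open>N\<close>
      remains.\<close>
    from this(1)[rule_format, of 1]
    have "Cmp T' (ep (Dom T g)) ?k = Cmp T' (far N f) (ep (Dom T f))" by (simp add: ep_def)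
    then show ?thesis
      using T'.Cmp_assoc[OF kh ep far] T'.Cmp_assoc[OF ep far far[OF fg(2), folded fg(3)]]
        theory_morphism_Cmp[OF N, of f "Dom T f" "Cod T f" g "Cod T g"] fg d
      by (simp add: hom_iff)
  qed
  have tup: "Cmp T' (far N (tuple T X fs)) (ep X) =
      tuple T' (W X) (map (\<lambda>f. Cmp T' (far N f) (ep (Dom T f))) fs)"
    if X: "X \<in> Ob T" and fs: "set fs \<subseteq> Ar T" "\<And>f. f \<in> set fs \<Longrightarrow> Dom T f = X" for X fs
  proof -
    \<comment> \<open>\<open>N\<close> preserves tuples, precomposition with \<open>ep X\<close>
      keeps the tuple property, and uniqueness of tuples then gives the relation.\<close>
    have h: "is_tuple T' (fob N X) (map (far N) fs) (far N (tuple T X fs))"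
      by (rule theory_morphism_tuple[OF equational_theory_axioms N fs is_tuple_tuple[OF X fs]])
    have Nfs: "set (map (far N) fs) \<subseteq> Ar T'" "\<And>f. f \<in> set (map (far N) fs) \<Longrightarrow> Dom T' f = fob N X"
      using far fs by (auto simp: hom_iff)
    have "is_tuple T' (W X) (map (\<lambda>f. Cmp T' f (ep X)) (map (far N) fs))
        (Cmp T' (far N (tuple T X fs)) (ep X))"
      by (rule T'.is_tuple_precomp[OF ep[OF X] in'[OF X] Nfs h])
    moreover have "map (\<lambda>f. Cmp T' f (ep X)) (map (far N) fs) =
        map (\<lambda>f. Cmp T' (far N f) (ep (Dom T f))) fs"
      using fs by simp
    ultimately have "is_tuple T' (W X) (map (\<lambda>f. Cmp T' (far N f) (ep (Dom T f))) fs)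
        (Cmp T' (far N (tuple T X fs)) (ep X))" by (simp only:)
    then show ?thesis
      using W[OF X] phi fs by (intro T'.tuple_eqI[symmetric]) (auto simp: hom_iff)
  qed
  have c: "Cmp T g f \<in> Ar T \<and> Dom T (Cmp T g f) = Dom T f"
    if "f \<in> Ar T" "g \<in> Ar T" "Cod T f = Dom T g" for f g
    using Cmp_hom[of f "Dom T f" "Cod T f" g "Cod T g"] that by (auto simp: hom_iff)
  have t: "tuple T X fs \<in> Ar T \<and> Dom T (tuple T X fs) = X"
    if "X \<in> Ob T" "set fs \<subseteq> Ar T" "\<And>f. f \<in> set fs \<Longrightarrow> Dom T f = X" for X fs
    using is_tuple_tuple[OF that] by (simp add: is_tuple_def hom_iff)
  show ?thesis unfolding Fexp_data_def W_def[symmetric] pr_def[symmetric] ep_def[symmetric]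
  proof (intro conjI ballI allI impI)
    fix X fs assume X: "X \<in> Ob T" and fs: "set fs \<subseteq> Ar T" "\<forall>f \<in> set fs. Dom T f = X"
    have "map (\<lambda>f \<in> Ar T. Cmp T' (far N f) (ep (Dom T f))) fs =
        map (\<lambda>f. Cmp T' (far N f) (ep (Dom T f))) fs"
      using fs by auto
    then show "(\<lambda>f \<in> Ar T. Cmp T' (far N f) (ep (Dom T f))) (tuple T X fs) =
        tuple T' (W X) (map (\<lambda>f \<in> Ar T. Cmp T' (far N f) (ep (Dom T f))) fs)"
      using X fs tup[of X fs] t[of X fs] by (simp del: map_eq_conv)
  qed (use F B phi comp c ar pure_Ar ob Cod_in in auto)
qed

section \<open>Models of \<open>Fexp T P\<close> over \<open>M0\<close>, computed on
  elements\<close>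

context decorated_theory begin

lemma aterm_eqI: "eqr X Y t s \<Longrightarrow> aterm T P X Y t = aterm T P X Y s"
  using equiv_typed aterm_eq_iff by blast

end

locale exp_model = decorated_theory T P
  for T :: "('o, 'm) thy" and P :: "'m set" +
  fixes M0 :: "('o, 'm, 'u) model" and M :: "('o atype, ('o, 'm) aterm, 'u) model"
  assumes M0: "is_model (pure_theory T P) M0" and M: "is_model E M"
    and over: "fcomp (pure_theory T P) M (Fexp_incl T P) = M0"
begin

lemma morphism: "theory_morphism E Sets M"
  using M by (simp add: is_model_def)

lemma morphism0: "theory_morphism (pure_theory T P) Sets M0"
  using M0 by (simp add: is_model_def)

text \<open>Terms of \<open>Fexp T P\<close> are classes of raw terms. Working with a raw
  representative and its two types allows induction on \<open>typed\<close> and turns equations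
  between maps into equations between elements.\<close>

abbreviation val where "val X Y t \<equiv> app (far M (aterm T P X Y t))"

lemma fob_Base: "X \<in> Ob T \<Longrightarrow> fob M (Base X) = fob M0 X"
  unfolding over[symmetric] by (simp add: fcomp_def compose_def Fexp_incl_def)

lemma far_Pure: "f \<in> P \<Longrightarrow> far M (aterm T P (Base (Dom T f)) (Base (Cod T f)) (Pure f)) = far M0 f"
  unfolding over[symmetric] by (simp add: fcomp_def compose_def Fexp_incl_def)

lemma fob_aprod: "set Zs \<subseteq> atypes T \<Longrightarrow> fob M (aprod T Zs) = cart (map (fob M) Zs)"
  using theory_morphism_Prd[OF morphism, of Zs] by simp

lemma fob_pair: "X \<in> Ob T \<Longrightarrow> fob M (aprod T [Param, Base X]) = cart [fob M Param, fob M0 X]"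
  by (subst fob_aprod) (auto simp: fob_Base intro: atypes.intros)

lemma far_hom: "ty X Y t \<Longrightarrow> far M (aterm T P X Y t) \<in> hom Sets (fob M X) (fob M Y)"
  by (rule theory_morphism_hom[OF morphism]) (auto simp: Fexp_hom_iff)

lemma val_in: "ty X Y t \<Longrightarrow> x \<in> fob M X \<Longrightarrow> val X Y t x \<in> fob M Y"
  using far_hom by (fastforce simp: Sets_hom_iff)

lemma val_RCmp:
  assumes t: "ty Y Z t" and s: "ty X Y s" and x: "x \<in> fob M X"
  shows "val X Z (RCmp t s) x = val Y Z t (val X Y s x)"
proof -
  have "far M (aterm T P X Z (RCmp t s)) = Cmp Sets (far M (aterm T P Y Z t)) (far M (aterm T P X Y s))"
    unfolding Cmp_aterm[OF t s, symmetric]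
    by (rule theory_morphism_Cmp[OF morphism]) (use t s in \<open>auto simp: Fexp_hom_iff\<close>)
  then show ?thesis using x far_hom[OF s] by (simp add: Sets_hom_iff compose_def)
qed

lemma val_RId: "X \<in> atypes T \<Longrightarrow> x \<in> fob M X \<Longrightarrow> val X X (RId X) x = x"
  using theory_morphism_Idt[OF morphism, of X] by simp

lemma val_RPrj:
  assumes "set Ys \<subseteq> atypes T" "i < length Ys" "list_all2 (\<in>) xs (map (fob M) Ys)"
  shows "val (aprod T Ys) (Ys ! i) (RPrj Ys i) (tup xs) = xs ! i"
  using theory_morphism_Prj[OF morphism, of Ys i] app_Prj_Sets[OF assms(3)] assms(1,2)
  by (simp only: Fexp_simps)

text \<open>A morphism of theories preserves projections and hence tuples, and tuples of maps of
  sets are computed entrywise.\<close>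

lemma val_RTup:
  assumes X: "X \<in> atypes T" and l: "list_all2 (ty X) Ys ts" and x: "x \<in> fob M X"
  shows "val X (aprod T Ys) (RTup X ts) x = tup (map2 (\<lambda>Y t. val X Y t x) Ys ts)"
proof -
  let ?fs = "map2 (aterm T P X) Ys ts"
  have "set ?fs \<subseteq> Ar E"
    using l by (fastforce simp: Fexp_Ar_iff set_zip list_all2_conv_all_nth
      simp del: split_paired_Ex split_paired_All)
  moreover have "Dom E f = X" if "f \<in> set ?fs" for f using that by auto
  ultimately have "is_tuple Sets (fob M X) (map (far M) ?fs) (far M (aterm T P X (aprod T Ys) (RTup X ts)))"
    using theory_morphism_tuple[OF Fexp_theory morphism, of ?fs X] aterm_is_tuple[OF X l] by blast
  from app_tuple_Sets[OF this x] show ?thesis by (simp add: comp_def case_prod_beta')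
qed

text \<open>This reads \<open>f'\<close> as a family of maps indexed by the parameter: for fixed
  \<open>a\<close>, \<open>act f a\<close> is the underlying map of \<open>f\<close> in the model of
  \<open>T\<close> at \<open>a\<close>.\<close>

definition act :: "'m \<Rightarrow> 'u univ \<Rightarrow> 'u univ \<Rightarrow> 'u univ" where
  "act f a x = app (far M (prime_term T P f)) (tup [a, x])"

lemma pair_in: "X \<in> Ob T \<Longrightarrow> a \<in> fob M Param \<Longrightarrow> x \<in> fob M0 X \<Longrightarrow>
    tup [a, x] \<in> fob M (aprod T [Param, Base X])"
  unfolding fob_pair by (intro tup_in_cart) auto

lemma val_pair_Prj:
  assumes "X \<in> Ob T" "a \<in> fob M Param" "x \<in> fob M0 X"
  shows "val (aprod T [Param, Base X]) Param (RPrj [Param, Base X] 0) (tup [a, x]) = a"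
    and "val (aprod T [Param, Base X]) (Base X) (RPrj [Param, Base X] 1) (tup [a, x]) = x"
  using val_RPrj[of "[Param, Base X]" 0 "[a, x]"] val_RPrj[of "[Param, Base X]" 1 "[a, x]"] assms
  by (auto simp: fob_Base intro: atypes.intros)

lemma act_in: "f \<in> Ar T \<Longrightarrow> a \<in> fob M Param \<Longrightarrow> x \<in> fob M0 (Dom T f) \<Longrightarrow> act f a x \<in> fob M0 (Cod T f)"
  using val_in[OF typed_Prime pair_in, of f a x] Dom_in Cod_in by (simp add: act_def prime_term_def fob_Base)

text \<open>The relation for a pure \<open>f\<close> factors \<open>f'\<close> through the second
  projection, so the parameter \<open>a\<close> has no influence.\<close>

lemma act_pure:
  assumes f: "f \<in> P" and a: "a \<in> fob M Param" and x: "x \<in> fob M0 (Dom T f)"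
  shows "act f a x = app (far M0 f) x"
proof -
  have d: "Dom T f \<in> Ob T" using f pure_Ar Dom_in by auto
  show ?thesis
    using val_RCmp[OF typed_Pure[OF f] Prj_typed(2)[OF d] pair_in[OF d a x]] val_pair_Prj(2)[OF d a x]
    by (simp add: act_def prime_term_def aterm_eqI[OF eq_Prime_pure[OF f]] far_Pure[OF f])
qed

text \<open>The tuple of the first projection and \<open>f'\<close> sends the pair of
  \<open>a\<close> and \<open>x\<close> to the pair of \<open>a\<close> and
  \<open>act f a x\<close>: the relation for composites passes the same parameter on to
  \<open>g\<close>.\<close>

lemma act_Cmp:
  assumes fg: "f \<in> Ar T" "g \<in> Ar T" "Cod T f = Dom T g"
    and a: "a \<in> fob M Param" and x: "x \<in> fob M0 (Dom T f)"
  shows "act (Cmp T g f) a x = act g a (act f a x)"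
proof -
  let ?X = "aprod T [Param, Base (Dom T f)]"
  let ?t = "RTup ?X [RPrj [Param, Base (Dom T f)] 0, Prime f]"
  have d: "Dom T (Cmp T g f) = Dom T f" "Cod T (Cmp T g f) = Cod T g"
    using Cmp_hom[of f "Dom T f" "Cod T f" g "Cod T g"] fg by (auto simp: hom_iff)
  have D: "Dom T f \<in> Ob T" using fg Dom_in by auto
  have X: "?X \<in> atypes T" using D by (auto intro!: aprod_in atypes.intros)
  have l: "list_all2 (ty ?X) [Param, Base (Dom T g)] [RPrj [Param, Base (Dom T f)] 0, Prime f]"
    using fg D by (auto intro!: Prj_typed Prime_hom simp: hom_iff)
  note p = pair_in[OF D a x]
  have "act (Cmp T g f) a x = val ?X (Base (Cod T g)) (RCmp (Prime g) ?t) (tup [a, x])"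
    by (simp add: act_def prime_term_def d aterm_eqI[OF eq_Prime_Cmp[OF fg]])
  also have "\<dots> = val (aprod T [Param, Base (Dom T g)]) (Base (Cod T g)) (Prime g)
      (val ?X (aprod T [Param, Base (Dom T g)]) ?t (tup [a, x]))"
    by (rule val_RCmp[OF typed_Prime[OF fg(2)] typed_RTup[OF X l] p])
  also have "\<dots> = act g a (act f a x)"
    unfolding val_RTup[OF X l p] using val_pair_Prj(1)[OF D a x] fg(3) by (simp add: act_def prime_term_def)
  finally show ?thesis .
qed

section \<open>The model of \<open>T\<close> at a parameter value\<close>

lemma model_at_simps [simp]:
  "X \<in> Ob T \<Longrightarrow> fob (model_at T P M0 M a) X = fob M0 X"
  "f \<in> Ar T \<Longrightarrow> far (model_at T P M0 M a) f =
    SetMap (fob M0 (Dom T f)) (\<lambda>x \<in> fob M0 (Dom T f). act f a x) (fob M0 (Cod T f))"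
  by (simp_all add: model_at_def act_def)

lemma model_at_pure:
  assumes a: "a \<in> fob M Param" and f: "f \<in> P"
  shows "far (model_at T P M0 M a) f = far M0 f"
proof -
  have "far M0 f \<in> hom Sets (fob M0 (Dom T f)) (fob M0 (Cod T f))"
    using theory_morphism_hom[OF morphism0, of f] f by (simp add: hom_iff)
  then show ?thesis
    using f a pure_Ar act_pure[OF f a]
    by (intro setmap.expand) (auto simp: Sets_hom_iff PiE_def extensional_def fun_eq_iff)
qed

text \<open>Identities and projections are pure and are therefore interpreted as in
  \<open>M0\<close>; composition of arbitrary terms is \<open>act_Cmp\<close>.\<close>

lemma model_at_model:
  assumes a: "a \<in> fob M Param"
  shows "is_model T (model_at T P M0 M a)"
  unfolding is_model_def theory_morphism_def
proof (intro conjI ballI allI impI)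
  let ?N = "model_at T P M0 M a"
  show "fob ?N \<in> Ob T \<rightarrow>\<^sub>E Ob Sets" by (auto simp: model_at_def)
  have "far ?N f \<in> Ar Sets" if "f \<in> Ar T" for f
    using that act_in[OF that a] by (auto simp: Sets_Ar_iff)
  moreover have "far ?N \<in> extensional (Ar T)" by (simp add: model_at_def)
  ultimately show "far ?N \<in> Ar T \<rightarrow>\<^sub>E Ar Sets" by (simp add: PiE_def)
next
  fix X assume X: "X \<in> Ob T"
  then show "far (model_at T P M0 M a) (Idt T X) = Idt Sets (fob (model_at T P M0 M a) X)"
    using theory_morphism_Idt[OF morphism0, of X] by (simp add: model_at_pure[OF a pure_Idt[OF X]])
next
  fix f g assume fg: "f \<in> Ar T" "g \<in> Ar T" "Cod T f = Dom T g"
  have "Cmp T g f \<in> Ar T" "Dom T (Cmp T g f) = Dom T f" "Cod T (Cmp T g f) = Cod T g"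
    using Cmp_hom[of f "Dom T f" "Cod T f" g "Cod T g"] fg by (auto simp: hom_iff)
  then show "far (model_at T P M0 M a) (Cmp T g f) =
      Cmp Sets (far (model_at T P M0 M a) g) (far (model_at T P M0 M a) f)"
    using fg act_Cmp[OF fg a] act_in[OF fg(1) a] by (auto simp: compose_def fun_eq_iff)
next
  fix Xs assume Xs: "set Xs \<subseteq> Ob T"
  have m: "map (fob (model_at T P M0 M a)) Xs = map (fob M0) Xs" using Xs by auto
  show "fob (model_at T P M0 M a) (Prd T Xs) = Prd Sets (map (fob (model_at T P M0 M a)) Xs)"
    unfolding m using theory_morphism_Prd[OF morphism0, of Xs] Prd_in[OF Xs] Xs by simp
  fix i assume "i < length Xs"
  then show "far (model_at T P M0 M a) (Prj T Xs i) = Prj Sets (map (fob (model_at T P M0 M a)) Xs) i"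
    unfolding m using theory_morphism_Prj[OF morphism0, of Xs i] Xs
    by (simp add: model_at_pure[OF a pure_Prj] del: Sets_simps)
qed (simp_all add: Dom_in Cod_in)

lemma model_at_over:
  "a \<in> fob M Param \<Longrightarrow> fcomp (pure_theory T P) (model_at T P M0 M a) (pure_incl T P) = M0"
  unfolding over_pure_iff[OF morphism0] using model_at_pure by simp

end


section \<open>Arrows between models and maps between parameter sets\<close>

text \<open>The morphism of models induced by a map \<open>h\<close> between the parameter sets.\<close>

primrec ext_map :: "('u univ \<Rightarrow> 'u univ) \<Rightarrow> 'o atype \<Rightarrow> 'u univ \<Rightarrow> 'u univ" where
  "ext_map h (Base X) t = t"
| "ext_map h Param t = h t"
| "ext_map h (Prod Zs) t = tup (map2 (\<lambda>k. k) (map (ext_map h) Zs) (components (length Zs) t))"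

text \<open>If \<open>aprod\<close> collapses a list of \<open>Base\<close> types to a single
  \<open>Base\<close> type, both sides are \<open>tup xs\<close>, because \<open>ext_map\<close>
  fixes elements of base types. Otherwise this is the \<open>Prod\<close> clause, where a list of
  functions is applied entrywise to a list of arguments.\<close>

lemma ext_map_aprod:
  assumes "length xs = length Zs"
  shows "ext_map h (aprod T Zs) (tup xs) = tup (map2 (ext_map h) Zs xs)"
proof (cases "list_all is_Base Zs")
  case True
  then have "map2 (ext_map h) Zs xs = xs"
    using assms by (intro nth_equalityI) (auto simp: list_all_length is_Base_def)
  then show ?thesis using True by (simp add: aprod_def)
next
  case False
  have "map2 (\<lambda>k. k) (map (ext_map h) Zs) xs = map2 (ext_map h) Zs xs"
    using assms by (intro nth_equalityI) auto
  then show ?thesis using False components_tup[of xs] assms by (simp add: aprod_def)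
qed

locale exp_model_pair = M: exp_model T P M0 M + N: exp_model T P M0 N
  for T :: "('o, 'm) thy" and P M0 and M N :: "('o atype, ('o, 'm) aterm, 'u) model"
begin

lemma ext_map_in:
  assumes h: "h \<in> fob M Param \<rightarrow> fob N Param"
  shows "Z \<in> atypes T \<Longrightarrow> x \<in> fob M Z \<Longrightarrow> ext_map h Z x \<in> fob N Z"
proof (induction arbitrary: x rule: atypes.induct)
  case (atypes_Base X)
  then show ?case by (simp add: M.fob_Base N.fob_Base)
next
  case atypes_Param
  then show ?case using h by auto
next
  case (atypes_aprod Zs)
  then have Zs: "set Zs \<subseteq> atypes T" by auto
  obtain xs where xs: "x = tup xs" "list_all2 (\<in>) xs (map (fob M) Zs)" "length xs = length Zs"
    using atypes_aprod.prems cart_cases unfolding M.fob_aprod[OF Zs] by (metis length_map)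
  then show ?case
    using atypes_aprod.IH unfolding xs(1) ext_map_aprod[OF xs(3)] N.fob_aprod[OF Zs]
    by (intro tup_in_cart) (auto simp: list_all2_conv_all_nth)
qed

text \<open>Induction on raw terms reduces naturality to the generators. Pure terms are interpreted
  alike in both models, and for \<open>Prime f\<close> the map changes only the parameter of a pair,
  which is the case covered by the assumption on \<open>act\<close>.\<close>

lemma ext_map_natural:
  assumes h: "h \<in> fob M Param \<rightarrow> fob N Param"
    and act: "\<And>f a x. f \<in> Ar T \<Longrightarrow> a \<in> fob M Param \<Longrightarrow> x \<in> fob M0 (Dom T f) \<Longrightarrow>
      N.act f (h a) x = M.act f a x"
  shows "M.ty X Y t \<Longrightarrow> x \<in> fob M X \<Longrightarrow> N.val X Y t (ext_map h X x) = ext_map h Y (M.val X Y t x)"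
proof (induction arbitrary: x rule: typed.induct)
  case (typed_Pure f)
  then show ?case by (simp add: M.far_Pure N.far_Pure)
next
  case (typed_Prime f)
  note D = M.Dom_in[OF typed_Prime(1)]
  obtain a y where x: "x = tup [a, y]" "a \<in> fob M Param" "y \<in> fob M0 (Dom T f)"
    using typed_Prime(2) unfolding M.fob_pair[OF D] by (auto simp: cart_def list_all2_Cons2)
  have "ext_map h (aprod T [Param, Base (Dom T f)]) x = tup [h a, y]"
    unfolding x(1) by (subst ext_map_aprod) auto
  then show ?case using act[OF typed_Prime(1) x(2,3)]
    by (simp add: M.act_def N.act_def x(1) prime_term_def)
next
  case (typed_RId X)
  then show ?case by (simp add: M.val_RId N.val_RId ext_map_in[OF h])
next
  case (typed_RCmp Y Z t X s)
  then show ?case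
    using M.typed_in ext_map_in[OF h] M.val_in[OF typed_RCmp(2)]
    by (simp add: M.val_RCmp[OF typed_RCmp(1,2)] N.val_RCmp[OF typed_RCmp(1,2)])
next
  case (typed_RPrj Ys i)
  note Ys = typed_RPrj(1)
  obtain xs where xs: "x = tup xs" "list_all2 (\<in>) xs (map (fob M) Ys)" "length xs = length Ys"
    using typed_RPrj.prems cart_cases unfolding M.fob_aprod[OF Ys] by (metis length_map)
  have "list_all2 (\<in>) (map2 (ext_map h) Ys xs) (map (fob N) Ys)"
    using xs Ys nth_mem by (fastforce simp: list_all2_conv_all_nth intro!: ext_map_in[OF h])
  from N.val_RPrj[OF Ys typed_RPrj(2) this] show ?case
    using M.val_RPrj[OF Ys typed_RPrj(2) xs(2)] typed_RPrj(2) xs(3)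
    unfolding xs(1) ext_map_aprod[OF xs(3)] by simp
next
  case (typed_RTup X Ys ts)
  have l: "list_all2 (M.ty X) Ys ts" by (rule list_all2_mono[OF typed_RTup(2)]) simp
  have len: "length Ys = length ts" using l by (rule list_all2_lengthD)
  have "map2 (\<lambda>Y t. N.val X Y t (ext_map h X x)) Ys ts =
      map2 (ext_map h) Ys (map2 (\<lambda>Y t. M.val X Y t x) Ys ts)"
    using typed_RTup(2,3) len by (intro nth_equalityI) (auto simp: list_all2_conv_all_nth)
  then show ?case
    unfolding M.val_RTup[OF typed_RTup(1) l typed_RTup.prems]
      N.val_RTup[OF typed_RTup(1) l ext_map_in[OF h typed_RTup(1) typed_RTup.prems]]
    by (subst ext_map_aprod) (simp_all add: len)
qed

text \<open>A map of parameter sets compatible with the actions yields an arrow over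
  \<open>M0\<close>; \<open>arrow_act\<close> gives the passage back.\<close>

lemma ext_map_arrow:
  assumes h: "h \<in> fob M Param \<rightarrow> fob N Param"
    and act: "\<And>f a x. f \<in> Ar T \<Longrightarrow> a \<in> fob M Param \<Longrightarrow> x \<in> fob M0 (Dom T f) \<Longrightarrow>
      N.act f (h a) x = M.act f a x"
  shows "(M, \<lambda>Z \<in> atypes T. SetMap (fob M Z) (\<lambda>x \<in> fob M Z. ext_map h Z x) (fob N Z), N) \<in>
    hom (Mod_over (pure_theory T P) M.E (Fexp_incl T P) M0) M N"
proof -
  let ?m = "\<lambda>Z \<in> atypes T. SetMap (fob M Z) (\<lambda>x \<in> fob M Z. ext_map h Z x) (fob N Z)"
  have "natural_transformation M.E Sets M N ?m"
    unfolding natural_transformation_def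
  proof (intro conjI ballI)
    fix X assume "X \<in> Ob M.E"
    then show "?m X \<in> hom Sets (fob M X) (fob N X)"
      using ext_map_in[OF h] by (auto simp: Sets_hom_iff)
  next
    fix f assume "f \<in> Ar M.E"
    then obtain X Y t where t: "M.ty X Y t" "f = aterm T P X Y t" by (auto simp: M.Fexp_Ar_iff)
    then show "Cmp Sets (far N f) (?m (Dom M.E f)) = Cmp Sets (?m (Cod M.E f)) (far M f)"
      using M.typed_in[OF t(1)] M.far_hom[OF t(1)] N.far_hom[OF t(1)]
        M.val_in[OF t(1)] ext_map_natural[OF h act t(1)]
      by (auto simp: Sets_hom_iff compose_def fun_eq_iff)
  qed simp
  \<comment> \<open>\<open>ext_map\<close> is the identity on \<open>Base\<close> types and both
    models restrict to \<open>M0\<close>, so the arrow lies over \<open>M0\<close>.\<close>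
  moreover have "?m (fob (Fexp_incl T P) X) = Idt Sets (fob M0 X)" if "X \<in> Ob T" for X
    using that by (simp add: Fexp_incl_def M.fob_Base N.fob_Base atypes_Base fun_eq_iff)
  ultimately show ?thesis
    by (simp add: hom_iff Mod_over_def M.M N.M M.over N.over)
qed

lemma arrow_in:
  assumes m: "(M', m, N') \<in> hom (Mod_over (pure_theory T P) M.E (Fexp_incl T P) M0) M N"
    and Z: "Z \<in> atypes T" "x \<in> fob M Z"
  shows "app (m Z) x \<in> fob N Z"
proof -
  have "m Z \<in> hom Sets (fob M Z) (fob N Z)"
    using m Z(1) by (auto simp: hom_iff[of "(M', m, N')"] Mod_over_def Let_def natural_transformation_def)
  then show ?thesis using Z(2) by (auto simp: Sets_hom_iff)
qed

text \<open>Naturality at the two projections determines \<open>m\<close> on pairs: it moves the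
  parameter by \<open>m Param\<close> and fixes the other component, \<open>m\<close> being the
  identity on base types. Naturality at \<open>f'\<close> then compares the two actions.\<close>

lemma arrow_act:
  assumes m: "(M', m, N') \<in> hom (Mod_over (pure_theory T P) M.E (Fexp_incl T P) M0) M N"
    and f: "f \<in> Ar T" and a: "a \<in> fob M Param" and x: "x \<in> fob M0 (Dom T f)"
  shows "N.act f (app (m Param) a) x = M.act f a x"
proof -
  have n: "natural_transformation M.E Sets M N m" and
    b: "\<And>X. X \<in> Ob T \<Longrightarrow> m (Base X) = Idt Sets (fob M0 X)"
    using m by (auto simp: hom_iff Mod_over_def Let_def Fexp_incl_def)
  have nat: "N.val X Y t (app (m X) y) = app (m Y) (M.val X Y t y)"
    if t: "M.ty X Y t" and y: "y \<in> fob M X" for X Y t y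
  proof -
    have X: "X \<in> atypes T" using M.typed_in[OF t] by simp
    have "aterm T P X Y t \<in> Ar M.E" using t M.Fexp_Ar_iff by blast
    then have "Cmp Sets (far N (aterm T P X Y t)) (m X) = Cmp Sets (m Y) (far M (aterm T P X Y t))"
      using n by (fastforce simp only: natural_transformation_def M.Dom_aterm M.Cod_aterm)
    moreover have "src (m X) = fob M X" using n X by (auto simp: natural_transformation_def Sets_hom_iff)
    moreover have "src (far M (aterm T P X Y t)) = fob M X" using M.far_hom[OF t] by (simp add: Sets_hom_iff)
    ultimately show ?thesis using y by (auto simp: compose_def dest: fun_cong[of _ _ y])
  qed
  note D = M.Dom_in[OF f]
  let ?X = "aprod T [Param, Base (Dom T f)]"
  have X: "?X \<in> atypes T" using D by (auto intro!: aprod_in atypes.intros)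
  note p = M.pair_in[OF D a x]
  \<comment> \<open>The image of the pair is some pair of \<open>b\<close> and \<open>y\<close>; the
    projections identify \<open>b\<close> as the image of \<open>a\<close> and \<open>y\<close> as
    \<open>x\<close>.\<close>
  obtain b y where y: "app (m ?X) (tup [a, x]) = tup [b, y]" "b \<in> fob N Param" "y \<in> fob M0 (Dom T f)"
    using arrow_in[OF m X p] unfolding N.fob_pair[OF D] by (auto simp: cart_def list_all2_Cons2)
  have "b = app (m Param) a"
    using nat[OF M.Prj_typed(1)[OF D] p] y M.val_pair_Prj(1)[OF D a x] N.val_pair_Prj(1)[OF D y(2,3)] by simp
  moreover have "y = x"
    using nat[OF M.Prj_typed(2)[OF D] p] y M.val_pair_Prj(2)[OF D a x] N.val_pair_Prj(2)[OF D y(2,3)] b[OF D] x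
    by simp
  moreover have "M.act f a x \<in> fob M0 (Cod T f)" by (rule M.act_in[OF f a x])
  ultimately show "N.act f (app (m Param) a) x = M.act f a x"
    using nat[OF typed_Prime[OF f] p] y(1) b[OF M.Cod_in[OF f]]
    by (simp add: M.act_def N.act_def prime_term_def)
qed

end

section \<open>Singleton parameter sets, terminality and the bijection\<close>

lemma exp_model_of_model:
  fixes N :: "('o, 'm, 'u) model"
  assumes dec: "decorated_theory T P" and M0: "is_model (pure_theory T P) M0"
    and N: "is_model T N" "fcomp (pure_theory T P) N (pure_incl T P) = M0"
  obtains M where "exp_model T P M0 M" "fob M Param = B"
    "\<And>f a x. f \<in> Ar T \<Longrightarrow> a \<in> B \<Longrightarrow> x \<in> fob M0 (Dom T f) \<Longrightarrow>
      exp_model.act T P M f a x = app (far N f) x"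
proof -
  \<comment> \<open>\<open>f'\<close> is interpreted as \<open>far N f\<close> after the second
    projection, so the action ignores the parameter. The universal property of
    \<open>Fexp T P\<close> turns these data into a model.\<close>
  let ?\<phi> = "\<lambda>f \<in> Ar T. Cmp Sets (far N f) (Prj Sets [B, fob M0 (Dom T f)] 1)"
  have "Fexp_data T P Sets M0 B ?\<phi>"
    using dec Sets_theory M0 N by (intro Fexp_data_const) (auto simp: is_model_def)
  then obtain M where mor: "theory_morphism (Fexp T P) Sets M"
    "fcomp (pure_theory T P) M (Fexp_incl T P) = M0" "fob M Param = B"
    "(\<lambda>f \<in> Ar T. far M (prime_term T P f)) = ?\<phi>"
    using Fexp_universal[OF dec Sets_theory] by blast
  interpret exp_model T P M0 M
    using dec M0 mor by (simp add: exp_model_def exp_model_axioms_def is_model_def)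
  show ?thesis
  proof (rule that[OF exp_model_axioms mor(3)])
    fix f a x assume f: "f \<in> Ar T" and ax: "a \<in> B" "x \<in> fob M0 (Dom T f)"
    let ?p = "Prj Sets [B, fob M0 (Dom T f)] 1"
    have l: "list_all2 (\<in>) [a, x] [B, fob M0 (Dom T f)]" using ax by simp
    have "far M (prime_term T P f) = Cmp Sets (far N f) ?p"
      using fun_cong[OF mor(4), of f] f by simp
    then have "act f a x = app (far N f) (app ?p (tup [a, x]))"
      using tup_in_cart[OF l] by (simp add: act_def compose_def)
    then show "act f a x = app (far N f) x" unfolding app_Prj_Sets[OF l] by simp
  qed
qed

lemma model_at_bij:
  fixes M0 :: "('o, 'm, 'u) model"
  assumes dec: "decorated_theory T P" and M0: "is_model (pure_theory T P) M0"
    and MA: "terminal_object (Mod_over (pure_theory T P) (Fexp T P) (Fexp_incl T P) M0) MA"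
  shows "bij_betw (model_at T P M0 MA) (fob MA Param)
      (Ob (Mod_over (pure_theory T P) T (pure_incl T P) M0))"
proof -
  let ?C = "Mod_over (pure_theory T P) (Fexp T P) (Fexp_incl T P) M0"
  have obC: "K \<in> Ob ?C \<longleftrightarrow> is_model (Fexp T P) K \<and> fcomp (pure_theory T P) K (Fexp_incl T P) = M0" for K
    by (simp add: Mod_over_def Let_def)
  have "exp_model T P M0 MA"
    using dec M0 MA unfolding terminal_object_def obC by (simp add: exp_model_def exp_model_axioms_def)
  interpret A: exp_model T P M0 MA by fact
  have "\<exists>!a. a \<in> fob MA Param \<and> model_at T P M0 MA a = N"
    if N: "is_model T N" "fcomp (pure_theory T P) N (pure_incl T P) = M0" for N
  proof -
    \<comment> \<open>The choice of \<open>u\<close> is arbitrary; what matters is that the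
      parameter set \<open>{u}\<close> of \<open>K\<close> is a singleton.\<close>
    define u :: "'u univ" where "u = Tup []"
    obtain K where K: "exp_model T P M0 K" "fob K Param = {u}" and
      Kact: "\<And>f a x. f \<in> Ar T \<Longrightarrow> a \<in> {u} \<Longrightarrow> x \<in> fob M0 (Dom T f) \<Longrightarrow>
        exp_model.act T P K f a x = app (far N f) x"
      using exp_model_of_model[OF dec M0 N, of "{u}"] by blast
    interpret K: exp_model T P M0 K by fact
    interpret KA: exp_model_pair T P M0 K MA ..
    have Nob: "fob N X = fob M0 X" if "X \<in> Ob T" for X
      using N(2) that unfolding over_pure_iff[OF A.morphism0] by simp
    have Nar: "far N f \<in> hom Sets (fob M0 (Dom T f)) (fob M0 (Cod T f))" if "f \<in> Ar T" for f
      using theory_morphism_hom[of T Sets N f "Dom T f" "Cod T f"] N(1) that Nob A.Dom_in A.Cod_in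
      by (simp add: is_model_def hom_iff)
    \<comment> \<open>Both models of \<open>T\<close> agree with \<open>M0\<close> on types, so only
      their values on terms are compared. The right-hand side is exactly compatibility of the map
      from \<open>u\<close> to \<open>a\<close> with the actions of \<open>K\<close> and
      \<open>MA\<close>.\<close>
    have iff: "model_at T P M0 MA a = N \<longleftrightarrow>
        (\<forall>f \<in> Ar T. \<forall>x \<in> fob M0 (Dom T f). A.act f a x = K.act f u x)" for a
    proof
      assume e: "model_at T P M0 MA a = N"
      show "\<forall>f \<in> Ar T. \<forall>x \<in> fob M0 (Dom T f). A.act f a x = K.act f u x"
        using A.model_at_simps(2)[of _ a] unfolding e by (auto simp: Kact)
    next
      assume e: "\<forall>f \<in> Ar T. \<forall>x \<in> fob M0 (Dom T f). A.act f a x = K.act f u x"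
      have "fob (model_at T P M0 MA a) = fob N"
        using N(1) by (intro extensionalityI[where A="Ob T"])
          (auto simp: is_model_def theory_morphism_def PiE_def model_at_def Nob)
      moreover have "far (model_at T P M0 MA a) = far N"
      proof (rule extensionalityI[where A="Ar T"])
        show "far (model_at T P M0 MA a) \<in> extensional (Ar T)" by (simp add: model_at_def)
        show "far N \<in> extensional (Ar T)" using N(1) by (simp add: is_model_def theory_morphism_def PiE_def)
        fix f assume f: "f \<in> Ar T"
        then have "app (far N f) \<in> extensional (fob M0 (Dom T f))"
          using Nar by (auto simp: Sets_hom_iff PiE_def)
        then have "(\<lambda>x \<in> fob M0 (Dom T f). A.act f a x) = app (far N f)"
          using e f Kact by (intro extensionalityI[where A="fob M0 (Dom T f)"]) auto
        then show "far (model_at T P M0 MA a) f = far N f"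
          using f Nar[OF f] by (intro setmap.expand) (simp add: Sets_hom_iff)
      qed
      ultimately show "model_at T P M0 MA a = N" by simp
    qed
    have "K \<in> Ob ?C" using K.M K.over unfolding obC ..
    then have "\<exists>!k. k \<in> hom ?C K MA" using MA unfolding terminal_object_def by (elim conjE bspec)
    then obtain k where k: "k \<in> hom ?C K MA" and k_unique: "\<And>l. l \<in> hom ?C K MA \<Longrightarrow> l = k"
      by (elim ex1E) metis
    obtain K' m A' where kk: "k = (K', m, A')" by (cases k)
    note k' = k[unfolded kk]
    \<comment> \<open>The required parameter value is the image of the single point \<open>u\<close>
      under the unique arrow from \<open>K\<close> to \<open>MA\<close>.\<close>
    have Ar: "app (m Param) u \<in> fob MA Param"
      using KA.arrow_in[OF k' atypes_Param] K(2) by simp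
    show ?thesis
    proof (rule ex1I[of _ "app (m Param) u"])
      show "app (m Param) u \<in> fob MA Param \<and> model_at T P M0 MA (app (m Param) u) = N"
        unfolding iff using Ar KA.arrow_act[OF k'] K(2) by simp
    next
      fix a assume a: "a \<in> fob MA Param \<and> model_at T P M0 MA a = N"
      \<comment> \<open>Any other solution \<open>a\<close> makes the constant map with value
        \<open>a\<close> compatible with the actions. Its induced arrow must equal \<open>k\<close>,
        and comparing both at \<open>Param\<close> and \<open>u\<close> gives
        \<open>a\<close>.\<close>
      let ?n = "\<lambda>Z \<in> atypes T. SetMap (fob K Z) (\<lambda>x \<in> fob K Z. ext_map (\<lambda>_. a) Z x) (fob MA Z)"
      have "(K, ?n, MA) = k"
        using a iff[of a] K(2) by (intro k_unique KA.ext_map_arrow) auto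
      then have "m = ?n" unfolding kk by (elim Pair_inject) (rule sym)
      then show "a = app (m Param) u" using K(2) by (simp add: atypes_Param)
    qed
  qed
  then have "\<exists>!a. a \<in> fob MA Param \<and> model_at T P M0 MA a = N"
    if "N \<in> Ob (Mod_over (pure_theory T P) T (pure_incl T P) M0)" for N
    using that by (simp add: Mod_over_def Let_def)
  moreover have "model_at T P M0 MA a \<in> Ob (Mod_over (pure_theory T P) T (pure_incl T P) M0)"
    if "a \<in> fob MA Param" for a
    using A.model_at_model[OF that] A.model_at_over[OF that] by (simp add: Mod_over_def Let_def)
  ultimately show ?thesis unfolding bij_betw_def inj_on_def by blast
qed

theorem corollary3p8:
  fixes T :: "('o, 'm) thy" and P :: "'m set"
    and M0 :: "('o, 'm, 'u) model"
    and MA :: "('o atype, ('o, 'm) aterm, 'u) model"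
  assumes "decorated_theory T P"
    and "is_model (pure_theory T P) M0"
    and "terminal_object (Mod_over (pure_theory T P) (Fexp T P) (Fexp_incl T P) M0) MA"
  shows "bij_betw (model_at T P M0 MA) (fob MA Param)
      (Ob (Mod_over (pure_theory T P) T (pure_incl T P) M0)) \<and>
    (\<forall>\<alpha> \<in> fob MA Param. \<forall>f \<in> P.
      far (model_at T P M0 MA \<alpha>) f = far MA (far (Fexp_incl T P) f))"
proof
  show "bij_betw (model_at T P M0 MA) (fob MA Param)
      (Ob (Mod_over (pure_theory T P) T (pure_incl T P) M0))"
    by (rule model_at_bij[OF assms])
  interpret exp_model T P M0 MA
    using assms by (simp add: terminal_object_def Mod_over_def Let_def exp_model_def exp_model_axioms_def)
  show "\<forall>\<alpha> \<in> fob MA Param. \<forall>f \<in> P.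
      far (model_at T P M0 MA \<alpha>) f = far MA (far (Fexp_incl T P) f)"
    by (simp add: model_at_pure far_Pure Fexp_incl_def)
qed

end
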